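(* Let $G$ be a connected locally finite graph, let $N$ be a tree of tangles of $G$, and let $((A_i,B_i))_{i\in\mathbb N}$ be a strictly increasing sequence of oriented separations each of whose underlying separations lies in $N$, with limit $(A,B)=(\bigcup_i A_i,\bigcap_i B_i)$. If $B\neq\emptyset$, then $G$ has exactly one end that lies in the closure of $A\cap B$, and this end is thick.
   Context: A separation of $G$ is an unordered pair $\{A,B\}$ of subsets of $V(G)$ with $A\cup B=V(G)$ such that no edge of $G$ joins $A\setminus B$ to $B\setminus A$; its order is $|A\cap B|$. Its orientations are $(A,B)$ and $(B,A)$, partially ordered by $(A,B)\le (C,D)$ iff $A\subseteq C$ and $B\supseteq D$; strictly increasing means $(A_i,B_i)<(A_{i+1},B_{i+1})$ for all $i$. Two separations are nested if some orientations of them are comparable; a set of separations is nested if its elements are pairwise nested. A set $O$ of oriented separations is consistent if there are no $(A,B),(C,D)\in O$ with $\{A,B\}\ne\{C,D\}$ and $(B,A)\le(C,D)$. A pre-tangle is a consistent set $P$ which, for some $k\in\mathbb N\cup\{\aleph_0\}$, contains exactly one orientation of each separation of order $<k$ and nothing else. A tangle is a pre-tangle $P$ such that $G[A_1]\cup G[A_2]\cup G[A_3]\neq G$ for any $(A_1,B_1),(A_2,B_2),(A_3,B_3)\in P$. A separation distinguishes two tangles if both orient it but differently; efficiently if it has minimal order among such separations. A tree of tangles of $G$ is a nested set $N$ of separations such that every two tangles distinguished by some separation are efficiently distinguished by some element of $N$, and every element of $N$ efficiently distinguishes some two tangles. An end of $G$ is an equivalence class of rays (equivalent if not separated by a finite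 vertex set); it is thick if it contains infinitely many disjoint rays. A comb is the union of a ray $R$ (its spine) with infinitely many disjoint finite paths having exactly their first vertex on $R$; their last vertices are the teeth. An end $\omega$ lies in the closure of $U\subseteq V(G)$ if $G$ contains a comb with all teeth in $U$ whose spine belongs to $\omega$. *)

theory Defs
  imports Main "HOL-Library.Extended_Nat"
begin

definition graph :: "'v set \<Rightarrow> ('v \<Rightarrow> 'v \<Rightarrow> bool) \<Rightarrow> bool" where
  "graph V E \<longleftrightarrow> (\<forall>x y. E x y \<longrightarrow> x \<in> V \<and> y \<in> V \<and> E y x \<and> x \<noteq> y)"

definition locally_finite :: "'v set \<Rightarrow> ('v \<Rightarrow> 'v \<Rightarrow> bool) \<Rightarrow> bool" where
  "locally_finite V E \<longleftrightarrow> (\<forall>v\<in>V. finite {u. E v u})"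

definition gpath :: "'v set \<Rightarrow> ('v \<Rightarrow> 'v \<Rightarrow> bool) \<Rightarrow> 'v list \<Rightarrow> bool" where
  "gpath V E xs \<longleftrightarrow> xs \<noteq> [] \<and> distinct xs \<and> set xs \<subseteq> V \<and>
     (\<forall>i. Suc i < length xs \<longrightarrow> E (xs ! i) (xs ! Suc i))"

definition connected_graph :: "'v set \<Rightarrow> ('v \<Rightarrow> 'v \<Rightarrow> bool) \<Rightarrow> bool" where
  "connected_graph V E \<longleftrightarrow> V \<noteq> {} \<and>
     (\<forall>u\<in>V. \<forall>v\<in>V. \<exists>xs. gpath V E xs \<and> hd xs = u \<and> last xs = v)"

definition is_osep :: "'v set \<Rightarrow> ('v \<Rightarrow> 'v \<Rightarrow> bool) \<Rightarrow> 'v set \<Rightarrow> 'v set \<Rightarrow> bool" where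
  "is_osep V E A B \<longleftrightarrow> A \<union> B = V \<and> (\<forall>x y. x \<in> A - B \<longrightarrow> y \<in> B - A \<longrightarrow> \<not> E x y)"

definition is_separation :: "'v set \<Rightarrow> ('v \<Rightarrow> 'v \<Rightarrow> bool) \<Rightarrow> 'v set set \<Rightarrow> bool" where
  "is_separation V E s \<longleftrightarrow> (\<exists>A B. s = {A, B} \<and> is_osep V E A B)"

definition orientations :: "'v set set \<Rightarrow> ('v set \<times> 'v set) set" where
  "orientations s = {(A, B). s = {A, B}}"

definition sep_order :: "'v set set \<Rightarrow> enat" where
  "sep_order s = (if finite (\<Inter>s) then enat (card (\<Inter>s)) else \<infinity>)"

definition sep_le :: "'v set \<times> 'v set \<Rightarrow> 'v set \<times> 'v set \<Rightarrow> bool" where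
  "sep_le p q \<longleftrightarrow> fst p \<subseteq> fst q \<and> snd q \<subseteq> snd p"

definition sep_less :: "'v set \<times> 'v set \<Rightarrow> 'v set \<times> 'v set \<Rightarrow> bool" where
  "sep_less p q \<longleftrightarrow> sep_le p q \<and> p \<noteq> q"

definition nested :: "'v set set \<Rightarrow> 'v set set \<Rightarrow> bool" where
  "nested s t \<longleftrightarrow> (\<exists>p\<in>orientations s. \<exists>q\<in>orientations t. sep_le p q)"

definition nested_set :: "'v set set set \<Rightarrow> bool" where
  "nested_set N \<longleftrightarrow> (\<forall>s\<in>N. \<forall>t\<in>N. nested s t)"

definition consistent :: "('v set \<times> 'v set) set \<Rightarrow> bool" where
  "consistent Os \<longleftrightarrow> \<not> (\<exists>A B C D. (A, B) \<in> Os \<and> (C, D) \<in> Os \<and> {A, B} \<noteq> {C, D} \<and>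
      sep_le (B, A) (C, D))"

definition pre_tangle :: "'v set \<Rightarrow> ('v \<Rightarrow> 'v \<Rightarrow> bool) \<Rightarrow> ('v set \<times> 'v set) set \<Rightarrow> bool" where
  "pre_tangle V E P \<longleftrightarrow> consistent P \<and>
     (\<exists>k::enat.
        (\<forall>A B. (A, B) \<in> P \<longrightarrow> is_osep V E A B \<and> sep_order {A, B} < k) \<and>
        (\<forall>s. is_separation V E s \<and> sep_order s < k \<longrightarrow> card (P \<inter> orientations s) = 1))"

(* G[A1] \<union> G[A2] \<union> G[A3] = G *)
definition covers3 :: "'v set \<Rightarrow> ('v \<Rightarrow> 'v \<Rightarrow> bool) \<Rightarrow> 'v set \<Rightarrow> 'v set \<Rightarrow> 'v set \<Rightarrow> bool" where
  "covers3 V E A1 A2 A3 \<longleftrightarrow> (\<forall>Ai\<in>{A1, A2, A3}. Ai \<subseteq> V) \<and> A1 \<union> A2 \<union> A3 = V \<and>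
     (\<forall>x y. E x y \<longrightarrow> (\<exists>Ai\<in>{A1, A2, A3}. x \<in> Ai \<and> y \<in> Ai))"

definition tangle :: "'v set \<Rightarrow> ('v \<Rightarrow> 'v \<Rightarrow> bool) \<Rightarrow> ('v set \<times> 'v set) set \<Rightarrow> bool" where
  "tangle V E P \<longleftrightarrow> pre_tangle V E P \<and>
     (\<forall>A1 B1 A2 B2 A3 B3. (A1, B1) \<in> P \<longrightarrow> (A2, B2) \<in> P \<longrightarrow> (A3, B3) \<in> P \<longrightarrow>
        \<not> covers3 V E A1 A2 A3)"

definition distinguishes :: "'v set \<Rightarrow> ('v \<Rightarrow> 'v \<Rightarrow> bool) \<Rightarrow> 'v set set \<Rightarrow>
    ('v set \<times> 'v set) set \<Rightarrow> ('v set \<times> 'v set) set \<Rightarrow> bool" where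
  "distinguishes V E s P Q \<longleftrightarrow> is_separation V E s \<and>
     P \<inter> orientations s \<noteq> {} \<and> Q \<inter> orientations s \<noteq> {} \<and>
     P \<inter> orientations s \<noteq> Q \<inter> orientations s"

definition eff_distinguishes :: "'v set \<Rightarrow> ('v \<Rightarrow> 'v \<Rightarrow> bool) \<Rightarrow> 'v set set \<Rightarrow>
    ('v set \<times> 'v set) set \<Rightarrow> ('v set \<times> 'v set) set \<Rightarrow> bool" where
  "eff_distinguishes V E s P Q \<longleftrightarrow> distinguishes V E s P Q \<and>
     (\<forall>t. distinguishes V E t P Q \<longrightarrow> sep_order s \<le> sep_order t)"

definition tree_of_tangles :: "'v set \<Rightarrow> ('v \<Rightarrow> 'v \<Rightarrow> bool) \<Rightarrow> 'v set set set \<Rightarrow> bool" where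
  "tree_of_tangles V E N \<longleftrightarrow>
     (\<forall>s\<in>N. is_separation V E s) \<and> nested_set N \<and>
     (\<forall>P Q. tangle V E P \<and> tangle V E Q \<and> (\<exists>s. distinguishes V E s P Q) \<longrightarrow>
        (\<exists>s\<in>N. eff_distinguishes V E s P Q)) \<and>
     (\<forall>s\<in>N. \<exists>P Q. tangle V E P \<and> tangle V E Q \<and> eff_distinguishes V E s P Q)"

definition ray :: "'v set \<Rightarrow> ('v \<Rightarrow> 'v \<Rightarrow> bool) \<Rightarrow> (nat \<Rightarrow> 'v) \<Rightarrow> bool" where
  "ray V E R \<longleftrightarrow> inj R \<and> range R \<subseteq> V \<and> (\<forall>n. E (R n) (R (Suc n)))"

definition connected_avoiding :: "'v set \<Rightarrow> ('v \<Rightarrow> 'v \<Rightarrow> bool) \<Rightarrow> 'v set \<Rightarrow> 'v \<Rightarrow> 'v \<Rightarrow> bool" where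
  "connected_avoiding V E X u v \<longleftrightarrow>
     (\<exists>xs. gpath V E xs \<and> hd xs = u \<and> last xs = v \<and> set xs \<inter> X = {})"

definition ray_equiv :: "'v set \<Rightarrow> ('v \<Rightarrow> 'v \<Rightarrow> bool) \<Rightarrow> (nat \<Rightarrow> 'v) \<Rightarrow> (nat \<Rightarrow> 'v) \<Rightarrow> bool" where
  "ray_equiv V E R1 R2 \<longleftrightarrow> ray V E R1 \<and> ray V E R2 \<and>
     (\<forall>X. finite X \<longrightarrow> (\<exists>n m. (\<forall>k\<ge>n. R1 k \<notin> X) \<and> (\<forall>k\<ge>m. R2 k \<notin> X) \<and>
        connected_avoiding V E X (R1 n) (R2 m)))"

definition is_end :: "'v set \<Rightarrow> ('v \<Rightarrow> 'v \<Rightarrow> bool) \<Rightarrow> (nat \<Rightarrow> 'v) set \<Rightarrow> bool" where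
  "is_end V E \<omega> \<longleftrightarrow> (\<exists>R. ray V E R \<and> \<omega> = {R'. ray_equiv V E R R'})"

definition thick_end :: "'v set \<Rightarrow> ('v \<Rightarrow> 'v \<Rightarrow> bool) \<Rightarrow> (nat \<Rightarrow> 'v) set \<Rightarrow> bool" where
  "thick_end V E \<omega> \<longleftrightarrow> is_end V E \<omega> \<and>
     (\<exists>S\<subseteq>\<omega>. infinite S \<and> (\<forall>R\<in>S. \<forall>R'\<in>S. R \<noteq> R' \<longrightarrow> range R \<inter> range R' = {}))"

definition comb :: "'v set \<Rightarrow> ('v \<Rightarrow> 'v \<Rightarrow> bool) \<Rightarrow> (nat \<Rightarrow> 'v) \<Rightarrow> 'v set \<Rightarrow> bool" where
  "comb V E R U \<longleftrightarrow> ray V E R \<and>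
     (\<exists>Ps. infinite Ps \<and>
        (\<forall>p\<in>Ps. gpath V E p \<and> set p \<inter> range R = {hd p} \<and> last p \<in> U) \<and>
        (\<forall>p\<in>Ps. \<forall>q\<in>Ps. p \<noteq> q \<longrightarrow> set p \<inter> set q = {}))"

definition end_in_closure :: "'v set \<Rightarrow> ('v \<Rightarrow> 'v \<Rightarrow> bool) \<Rightarrow> (nat \<Rightarrow> 'v) set \<Rightarrow> 'v set \<Rightarrow> bool" where
  "end_in_closure V E \<omega> U \<longleftrightarrow> (\<exists>R\<in>\<omega>. comb V E R U)"

end

theory Submission
  imports Defs
begin

text \<open>
  Write \<open>U = A \<inter> B\<close>. If \<open>U\<close> were finite, some tangle efficiently distinguished by a late \<open>{A\<^sub>j, B\<^sub>j}\<close>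
  would violate the covering condition, so \<open>U\<close> is infinite. A separation \<open>(C, D)\<close> of order
  \<open>k < |A\<^sub>j \<inter> B\<^sub>j|\<close> cannot distinguish the two tangles efficiently distinguished by \<open>{A\<^sub>j, B\<^sub>j}\<close>; the corner
  separations then show that \<open>A\<^sub>j \<inter> B\<^sub>j\<close>, and in the limit \<open>U\<close>, has at most \<open>k\<close> vertices in one of
  \<open>C - D\<close>, \<open>D - C\<close>. Hence for every finite \<open>X\<close> exactly one component of \<open>G - X\<close> contains almost all of
  \<open>U\<close>, which gives the unique end in the closure of \<open>U\<close>. A finite set separating \<open>n\<close> vertices of \<open>U\<close>
  from this end has at least \<open>n / 2\<close> elements. So there are ever larger separators \<open>Z\<^sub>0, Z\<^sub>1, ...\<close>
  converging to the end, each of minimum size for some set that it separates from the end. By Menger's theorem all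
  of \<open>Z\<^sub>n\<close> can be linked to \<open>Z\<^sub>n\<^sub>+\<^sub>1\<close>, and concatenating these linkages yields infinitely many disjoint
  rays of the end.
\<close>

section \<open>Menger's theorem\<close>

text \<open>Vertices may repeat, so that walks can be cut and concatenated freely; only the members
  of a \<open>linkage\<close> have to be paths.\<close>

definition walk :: "('v \<Rightarrow> 'v \<Rightarrow> bool) \<Rightarrow> 'v set \<Rightarrow> 'v set \<Rightarrow> 'v list \<Rightarrow> bool" where
  "walk E A B p \<longleftrightarrow> p \<noteq> [] \<and> successively E p \<and> hd p \<in> A \<and> last p \<in> B"

definition separator :: "('v \<Rightarrow> 'v \<Rightarrow> bool) \<Rightarrow> 'v set \<Rightarrow> 'v set \<Rightarrow> 'v set \<Rightarrow> bool" where
  "separator E A B W \<longleftrightarrow> (\<forall>p. walk E A B p \<longrightarrow> set p \<inter> W \<noteq> {})"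

definition linkage :: "('v \<Rightarrow> 'v \<Rightarrow> bool) \<Rightarrow> 'v set \<Rightarrow> 'v set \<Rightarrow> 'v list set \<Rightarrow> bool" where
  "linkage E A B P \<longleftrightarrow> finite P \<and> (\<forall>p\<in>P. walk E A B p \<and> distinct p) \<and>
     (\<forall>p\<in>P. \<forall>q\<in>P. p \<noteq> q \<longrightarrow> set p \<inter> set q = {})"

lemma linkage_mono:
  assumes "linkage E A B P" "\<And>x y. E x y \<Longrightarrow> E' x y"
  shows "linkage E' A B P"
proof -
  have "walk E' A B p" if "walk E A B p" for p
    using that assms(2) unfolding walk_def by (auto elim!: successively_mono)
  then show ?thesis using assms(1) unfolding linkage_def by blast
qed

lemma inj_on_last_linkage: "linkage E A B P \<Longrightarrow> inj_on last P"
  unfolding linkage_def walk_def inj_on_def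
  by (metis disjoint_iff last_in_set)

lemma inj_on_hd_linkage: "linkage E A B P \<Longrightarrow> inj_on hd P"
  unfolding linkage_def walk_def inj_on_def
  by (metis disjoint_iff hd_in_set)

lemma linkage_separator_inj:
  assumes "linkage E A B P" "finite W" "separator E A B W"
  obtains g where "inj_on g P" "\<And>p. p \<in> P \<Longrightarrow> g p \<in> set p \<inter> W"
proof -
  have "\<forall>p\<in>P. \<exists>x. x \<in> set p \<inter> W"
    using assms unfolding linkage_def separator_def by blast
  then obtain g where g: "\<forall>p\<in>P. g p \<in> set p \<inter> W" by metis
  moreover have "inj_on g P"
    using assms(1) g unfolding linkage_def inj_on_def by (metis IntD1 disjoint_iff)
  ultimately show ?thesis using that by blast
qed

text \<open>Disjoint paths have distinct last vertices, so \<open>card B\<close> of them use up all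
  of \<open>B\<close>. Each vertex of \<open>B\<close> lies on the path ending there, hence on no
  other path.\<close>

lemma linkage_bij_last:
  assumes "linkage E A B P" "finite B" "card P = card B"
  obtains p where "\<And>s. s \<in> B \<Longrightarrow> p s \<in> P \<and> last (p s) = s"
    and "\<And>s t. s \<in> B \<Longrightarrow> t \<in> B \<Longrightarrow> s \<noteq> t \<Longrightarrow> set (p s) \<inter> set (p t) = {}"
    and "\<And>s. s \<in> B \<Longrightarrow> set (p s) \<inter> B = {s}"
proof -
  have sub: "last ` P \<subseteq> B" using assms(1) unfolding linkage_def walk_def by auto
  have "card (last ` P) = card B"
    using inj_on_last_linkage[OF assms(1)] assms(3) by (simp add: card_image)
  then have "last ` P = B" using sub assms(2) by (simp add: card_subset_eq)
  then have "\<forall>s\<in>B. \<exists>p. p \<in> P \<and> last p = s" by (metis imageE)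
  then obtain p where p: "\<And>s. s \<in> B \<Longrightarrow> p s \<in> P \<and> last (p s) = s" by metis
  have ne: "p s \<noteq> []" if "s \<in> B" for s
    using p[OF that] assms(1) unfolding linkage_def walk_def by blast
  have disj: "set (p s) \<inter> set (p t) = {}" if "s \<in> B" "t \<in> B" "s \<noteq> t" for s t
    using p[OF that(1)] p[OF that(2)] that(3) assms(1) unfolding linkage_def by metis
  have "set (p s) \<inter> B = {s}" if s: "s \<in> B" for s
  proof -
    have "t \<in> set (p t)" if "t \<in> B" for t using p[OF that] ne[OF that] last_in_set by metis
    then show ?thesis using disj s by blast
  qed
  then show ?thesis using that p disj by blast
qed

lemma linkage_bij_hd:
  assumes "linkage E A B P" "finite A" "card P = card A"
  obtains p where "\<And>s. s \<in> A \<Longrightarrow> p s \<in> P \<and> hd (p s) = s"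
    and "\<And>s t. s \<in> A \<Longrightarrow> t \<in> A \<Longrightarrow> s \<noteq> t \<Longrightarrow> set (p s) \<inter> set (p t) = {}"
    and "\<And>s. s \<in> A \<Longrightarrow> set (p s) \<inter> A = {s}"
proof -
  have sub: "hd ` P \<subseteq> A" using assms(1) unfolding linkage_def walk_def by auto
  have "card (hd ` P) = card A"
    using inj_on_hd_linkage[OF assms(1)] assms(3) by (simp add: card_image)
  then have "hd ` P = A" using sub assms(2) by (simp add: card_subset_eq)
  then have "\<forall>s\<in>A. \<exists>p. p \<in> P \<and> hd p = s" by (metis imageE)
  then obtain p where p: "\<And>s. s \<in> A \<Longrightarrow> p s \<in> P \<and> hd (p s) = s" by metis
  have ne: "p s \<noteq> []" if "s \<in> A" for s
    using p[OF that] assms(1) unfolding linkage_def walk_def by blast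
  have disj: "set (p s) \<inter> set (p t) = {}" if "s \<in> A" "t \<in> A" "s \<noteq> t" for s t
    using p[OF that(1)] p[OF that(2)] that(3) assms(1) unfolding linkage_def by metis
  have "set (p s) \<inter> A = {s}" if s: "s \<in> A" for s
  proof -
    have "t \<in> set (p t)" if "t \<in> A" for t using p[OF that] ne[OF that] hd_in_set by metis
    then show ?thesis using disj s by blast
  qed
  then show ?thesis using that p disj by blast
qed

text \<open>A walk through the deleted edge meets \<open>x\<close>; a walk that avoids
  \<open>x\<close> survives the deletion and meets \<open>S\<close>.\<close>

lemma separator_insert_tail:
  assumes "separator (\<lambda>a b. E a b \<and> \<not> (a = x \<and> b = y)) A B S"
  shows "separator E A B (insert x S)"
  unfolding separator_def
proof (intro allI impI)
  fix p assume p: "walk E A B p"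
  show "set p \<inter> insert x S \<noteq> {}"
  proof (rule ccontr)
    assume neg: "\<not> ?thesis"
    then have "successively (\<lambda>a b. E a b \<and> \<not> (a = x \<and> b = y)) p"
      using p unfolding walk_def by (auto elim!: successively_mono)
    then show False using assms p neg unfolding separator_def walk_def by blast
  qed
qed

lemma separator_insert_head:
  assumes "separator (\<lambda>a b. E a b \<and> \<not> (a = x \<and> b = y)) A B S"
  shows "separator E A B (insert y S)"
  unfolding separator_def
proof (intro allI impI)
  fix p assume p: "walk E A B p"
  show "set p \<inter> insert y S \<noteq> {}"
  proof (rule ccontr)
    assume neg: "\<not> ?thesis"
    then have "successively (\<lambda>a b. E a b \<and> \<not> (a = x \<and> b = y)) p"
      using p unfolding walk_def by (auto elim!: successively_mono)
    then show False using assms p neg unfolding separator_def walk_def by blast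
  qed
qed

lemma walk_to_first:
  assumes "walk E A B p" "set p \<inter> S \<noteq> {}"
  obtains p1 v p2 where "p = p1 @ v # p2" "v \<in> S" "set p1 \<inter> S = {}" "walk E A S (p1 @ [v])"
proof -
  obtain p1 v p2 where s: "p = p1 @ v # p2" "v \<in> S" "\<forall>y\<in>set p1. y \<notin> S"
    using split_list_first_prop[of p "\<lambda>y. y \<in> S"] assms(2) by blast
  have "walk E A S (p1 @ [v])"
    using assms(1) s unfolding walk_def
    by (auto simp: successively_append_iff hd_append split: if_splits)
  then show ?thesis using that s by blast
qed

lemma walk_from_last:
  assumes "walk E A B p" "set p \<inter> S \<noteq> {}"
  obtains p1 v p2 where "p = p1 @ v # p2" "v \<in> S" "set p2 \<inter> S = {}" "walk E S B (v # p2)"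
proof -
  obtain p1 v p2 where s: "p = p1 @ v # p2" "v \<in> S" "\<forall>y\<in>set p2. y \<notin> S"
    using split_list_last_prop[of p "\<lambda>y. y \<in> S"] assms(2) by blast
  have "walk E S B (v # p2)"
    using assms(1) s unfolding walk_def
    by (auto simp: successively_append_iff)
  then show ?thesis using that s by blast
qed

text \<open>Directed form, by deleting one edge. If fewer than \<open>k\<close> vertices
  \<open>S\<close> then separate, \<open>A\<close> is linked to \<open>S\<close> plus the tail,
  \<open>S\<close> plus the head is linked to \<open>B\<close>, and the two linkages are glued along
  \<open>S\<close> and the deleted edge.\<close>

lemma menger_finite_edges:
  assumes "finite {(a, b). E a b}" "finite A" "finite B"
    and "\<And>W. finite W \<Longrightarrow> separator E A B W \<Longrightarrow> k \<le> card W"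
  shows "\<exists>P. linkage E A B P \<and> card P = k"
  using assms
proof (induction "card {(a, b). E a b}" arbitrary: E A B rule: less_induct)
  case less
  show ?case
  proof (cases "\<exists>x y. E x y")
    case False
    \<comment> \<open>Without edges a walk is a single vertex, so \<open>A \<inter> B\<close>
      separates and trivial paths suffice.\<close>
    then have single: "\<exists>v. p = [v]" if "p \<noteq> []" "successively E p" for p
      using that by (cases p rule: remdups_adj.cases) auto
    have "separator E A B (A \<inter> B)"
      unfolding separator_def walk_def by (auto dest!: single)
    then have "k \<le> card (A \<inter> B)" using less.prems by blast
    then obtain T where T: "T \<subseteq> A \<inter> B" "card T = k" "finite T"
      by (meson obtain_subset_with_card_n)
    have "linkage E A B ((\<lambda>v. [v]) ` T)"
      using T unfolding linkage_def walk_def by auto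
    moreover have "card ((\<lambda>v. [v]) ` T) = k"
      using T by (subst card_image) (auto simp: inj_on_def)
    ultimately show ?thesis by blast
  next
    case True
    then obtain x y where xy: "E x y" by blast
    define E' where "E' = (\<lambda>a b. E a b \<and> \<not> (a = x \<and> b = y))"
    have edges: "{(a, b). E' a b} = {(a, b). E a b} - {(x, y)}" unfolding E'_def by auto
    have smaller: "card {(a, b). E' a b} < card {(a, b). E a b}"
      unfolding edges using xy less.prems(1) by (intro psubset_card_mono) auto
    have fin': "finite {(a, b). E' a b}" unfolding edges using less.prems(1) by blast
    have E'E: "E' a b \<Longrightarrow> E a b" for a b unfolding E'_def by blast
    have link: "linkage E' A B P \<Longrightarrow> linkage E A B P" for P
      using linkage_mono[of E' A B P E] E'E by blast
    show ?thesis
    proof (cases "\<forall>W. finite W \<longrightarrow> separator E' A B W \<longrightarrow> k \<le> card W")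
      case True
      then obtain P where "linkage E' A B P" "card P = k"
        using less.hyps[OF smaller fin' less.prems(2,3)] by blast
      then show ?thesis using link by blast
    next
      case False
      then obtain S where S: "finite S" "separator E' A B S" "card S < k" by force
      have sepx: "separator E A B (insert x S)"
        using S(2) unfolding E'_def by (rule separator_insert_tail)
      have sepy: "separator E A B (insert y S)"
        using S(2) unfolding E'_def by (rule separator_insert_head)
      \<comment> \<open>\<open>S\<close> has fewer than \<open>k\<close> vertices and adding one end
        of the deleted edge gives a separator of \<open>E\<close>, so the new size is exactly
        \<open>k\<close>.\<close>
      have cx: "card (insert x S) = k \<and> x \<notin> S"
        using less.prems(4)[OF _ sepx] S by (auto simp: card_insert_if split: if_splits)
      have cy: "card (insert y S) = k \<and> y \<notin> S"
        using less.prems(4)[OF _ sepy] S by (auto simp: card_insert_if split: if_splits)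
      \<comment> \<open>Up to its first vertex in \<open>insert x S\<close>, a walk uses no edge
        that starts in \<open>x\<close>, so this piece avoids the deleted edge. Hence
        \<open>T\<close> separates in \<open>E\<close> too and has at least \<open>k\<close>
        elements.\<close>
      have "separator E A B T" if T: "separator E' A (insert x S) T" for T
        unfolding separator_def
      proof (intro allI impI)
        fix p assume p: "walk E A B p"
        then have "set p \<inter> insert x S \<noteq> {}" using sepx unfolding separator_def by blast
        then obtain p1 v p2 where s: "p = p1 @ v # p2" "set p1 \<inter> insert x S = {}"
          and w: "walk E A (insert x S) (p1 @ [v])"
          using walk_to_first[OF p] by metis
        have "successively E p1" "successively E' p1 \<longrightarrow> successively E' (p1 @ [v])"
          using w s(2) unfolding walk_def E'_def by (auto simp: successively_append_iff)
        moreover have "successively E' p1"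
          using \<open>successively E p1\<close> s(2) unfolding E'_def by (auto elim!: successively_mono)
        ultimately have "walk E' A (insert x S) (p1 @ [v])" using w unfolding walk_def by blast
        then show "set p \<inter> T \<noteq> {}" using T s(1) unfolding separator_def by fastforce
      qed
      then obtain P where P: "linkage E' A (insert x S) P" "card P = k"
        using less.hyps[OF smaller fin' less.prems(2), of "insert x S"] S(1) less.prems(4) by blast
      \<comment> \<open>Dually, after its last vertex in \<open>insert y S\<close> a walk uses no
        edge that ends in \<open>y\<close>.\<close>
      have "separator E A B T" if T: "separator E' (insert y S) B T" for T
        unfolding separator_def
      proof (intro allI impI)
        fix p assume p: "walk E A B p"
        then have "set p \<inter> insert y S \<noteq> {}" using sepy unfolding separator_def by blast
        then obtain p1 v p2 where s: "p = p1 @ v # p2" "set p2 \<inter> insert y S = {}"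
          and w: "walk E (insert y S) B (v # p2)"
          using walk_from_last[OF p] by metis
        have "successively E p2" "successively E' p2 \<longrightarrow> successively E' (v # p2)"
          using w s(2) unfolding walk_def E'_def by (auto simp: successively_Cons)
        moreover have "successively E' p2"
          using \<open>successively E p2\<close> s(2) unfolding E'_def by (auto elim!: successively_mono)
        ultimately have "walk E' (insert y S) B (v # p2)" using w unfolding walk_def by blast
        then show "set p \<inter> T \<noteq> {}" using T s(1) unfolding separator_def by fastforce
      qed
      then obtain Q where Q: "linkage E' (insert y S) B Q" "card Q = k"
        using less.hyps[OF smaller fin' _ less.prems(3), of "insert y S"] S(1) less.prems(4) by blast
      obtain p where p: "\<And>s. s \<in> insert x S \<Longrightarrow> p s \<in> P \<and> last (p s) = s"
        and pd: "\<And>s t. s \<in> insert x S \<Longrightarrow> t \<in> insert x S \<Longrightarrow> s \<noteq> t \<Longrightarrow> set (p s) \<inter> set (p t) = {}"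
        and pS: "\<And>s. s \<in> insert x S \<Longrightarrow> set (p s) \<inter> insert x S = {s}"
        using linkage_bij_last[OF P(1)] S(1) P(2) cx by (metis finite_insert)
      obtain q where q: "\<And>s. s \<in> insert y S \<Longrightarrow> q s \<in> Q \<and> hd (q s) = s"
        and qd: "\<And>s t. s \<in> insert y S \<Longrightarrow> t \<in> insert y S \<Longrightarrow> s \<noteq> t \<Longrightarrow> set (q s) \<inter> set (q t) = {}"
        and qS: "\<And>s. s \<in> insert y S \<Longrightarrow> set (q s) \<inter> insert y S = {s}"
        using linkage_bij_hd[OF Q(1)] S(1) Q(2) cy by (metis finite_insert)
      have pw: "walk E' A (insert x S) (p s) \<and> distinct (p s)" if "s \<in> insert x S" for s
        using p[OF that] P(1) unfolding linkage_def by blast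
      have qw: "walk E' (insert y S) B (q s) \<and> distinct (q s)" if "s \<in> insert y S" for s
        using q[OF that] Q(1) unfolding linkage_def by blast
      \<comment> \<open>Following \<open>p s\<close> up to \<open>v\<close> and \<open>q t\<close>
        from there on gives a walk without the deleted edge, so it meets \<open>S\<close>. Since
        \<open>p s\<close> meets \<open>S\<close> at most in its last vertex and \<open>q t\<close>
        at most in its first, this happens only at \<open>v\<close>.\<close>
      have cross: "v \<in> S \<and> v = s \<and> v = t"
        if s: "s \<in> insert x S" and t: "t \<in> insert y S" and v: "v \<in> set (p s)" "v \<in> set (q t)" for s t v
      proof -
        obtain a b where ab: "p s = a @ v # b" using v(1) by (meson split_list)
        obtain c d where cd: "q t = c @ v # d" using v(2) by (meson split_list)
        have aS: "w \<notin> S" if w: "w \<in> set a" for w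
        proof
          assume "w \<in> S"
          then have "w = s" using pS[OF s] w ab by auto
          then have "w = last (v # b)" using p[OF s] ab by simp
          then have "w \<in> set (v # b)" using last_in_set by blast
          then show False using pw[OF s] ab w by auto
        qed
        have dS: "w \<notin> S" if w: "w \<in> set d" for w
        proof
          assume "w \<in> S"
          then have "w = t" using qS[OF t] w cd by auto
          then have "w = hd (c @ [v])" using q[OF t] cd by (cases c) auto
          then have "w \<in> set (c @ [v])" using hd_in_set by blast
          then show False using qw[OF t] cd w by auto
        qed
        have "walk E' A B (a @ v # d)"
          using pw[OF s] qw[OF t] unfolding ab cd walk_def
          by (auto simp: successively_append_iff successively_Cons hd_append split: if_splits)
        then have "v \<in> S" using S(2) aS dS unfolding separator_def by fastforce
        then show ?thesis using pS[OF s] qS[OF t] v by auto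
      qed
      \<comment> \<open>\<open>g\<close> pairs \<open>x\<close> with \<open>y\<close> and each
        vertex of \<open>S\<close> with itself. The paths for \<open>x\<close> are joined by the
        deleted edge; all others share the vertex \<open>s\<close>, hence the
        \<open>tl\<close>.\<close>
      define g where "g s = (if s = x then y else s)" for s
      define r where "r s = (if s = x then p x @ q y else p s @ tl (q s))" for s
      have gy: "g s \<in> insert y S" if "s \<in> insert x S" for s using that unfolding g_def by auto
      have rset: "set (r s) \<subseteq> set (p s) \<union> set (q (g s))" for s
        unfolding r_def g_def by (cases "q s") auto
      have rdisj: "set (r s) \<inter> set (r t) = {}"
        if s: "s \<in> insert x S" and t: "t \<in> insert x S" and st: "s \<noteq> t" for s t
      proof -
        have g: "g s \<noteq> g t" using s t st cy unfolding g_def by auto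
        have pq: "set (p s') \<inter> set (q (g t')) = {}"
          if st': "s' \<in> insert x S" "t' \<in> insert x S" "s' \<noteq> t'" for s' t'
        proof (rule ccontr)
          assume "\<not> ?thesis"
          then obtain v where "v \<in> S" "v = s'" "v = g t'" using cross[OF st'(1) gy[OF st'(2)]] by blast
          then show False using st' cy unfolding g_def by (auto split: if_splits)
        qed
        show ?thesis
          using pq[OF s t st] pq[OF t s st[symmetric]]
          pd[OF s t st] qd[OF gy[OF s] gy[OF t] g] rset[of s] rset[of t] by blast
      qed
      have rwalk: "walk E A B (r s) \<and> distinct (r s)" if s: "s \<in> insert x S" for s
      proof (cases "s = x")
        case True
        have "set (p x) \<inter> set (q y) = {}" using cross[of x y] cx by auto
        moreover have "successively E (p x)" "successively E (q y)"
          using pw[of x] qw[of y] E'E unfolding walk_def by (auto elim!: successively_mono)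
        ultimately show ?thesis
          using pw[of x] qw[of y] p[of x] q[of y] xy True
          unfolding r_def walk_def by (auto simp: successively_append_iff)
      next
        case False
        then have sS: "s \<in> S" using s by blast
        obtain d where d: "q s = s # d" using q[of s] qw[of s] sS unfolding walk_def
          by (metis insertI2 list.exhaust_sel)
        have "set (p s) \<inter> set d = {}"
        proof -
          have "v = s" if "v \<in> set (p s)" "v \<in> set d" for v using cross[of s s v] sS that d by auto
          then show ?thesis using qw[of s] sS d by auto
        qed
        moreover have "successively E (p s)" "successively E (q s)"
          using pw[of s] qw[of s] sS E'E unfolding walk_def by (auto elim!: successively_mono)
        ultimately show ?thesis
          using pw[of s] qw[of s] p[of s] sS False d
          unfolding r_def walk_def
          by (auto simp: successively_append_iff successively_Cons split: if_splits)
      qed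
      have rinj: "inj_on r (insert x S)"
      proof (rule inj_onI, rule ccontr)
        fix s t assume st: "s \<in> insert x S" "t \<in> insert x S" "r s = r t" "s \<noteq> t"
        then have "set (r s) = {}" using rdisj[of s t] by simp
        then show False using rwalk[OF st(1)] unfolding walk_def by simp
      qed
      have "linkage E A B (r ` insert x S)"
        unfolding linkage_def using rwalk rdisj S(1) by fastforce
      moreover have "card (r ` insert x S) = k" using card_image[OF rinj] cx by argo
      ultimately show ?thesis by blast
    qed
  qed
qed

text \<open>If the largest number of disjoint paths is \<open>j < k\<close>, a separator of size \<open>j\<close> of any subgraph
  containing \<open>j\<close> disjoint paths consists of vertices of these paths. So there are only finitely
  many candidates, and finitely many walks suffice to refute all of them.\<close>

theorem menger:
  assumes fin: "finite A" "finite B"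
    and sep: "\<And>W. finite W \<Longrightarrow> separator E A B W \<Longrightarrow> k \<le> card W"
  shows "\<exists>P. linkage E A B P \<and> card P = k"
proof -
  have bound: "card P \<le> card A" if "linkage E A B P" for P
    using inj_on_hd_linkage[OF that] that fin
    by (intro card_inj_on_le[of hd]) (auto simp: linkage_def walk_def)
  have "linkage E A B {}" unfolding linkage_def by simp
  then obtain P where P: "linkage E A B P" and Pmax: "\<And>Q. linkage E A B Q \<Longrightarrow> card Q \<le> card P"
    using ex_has_greatest_nat[of "linkage E A B" "{}" card "Suc (card A)"] bound
    by (metis less_Suc_eq_le)
  have finP: "finite P" using P unfolding linkage_def by blast
  have "k \<le> card P"
  proof (rule ccontr)
    assume neg: "\<not> k \<le> card P"
    define VP where "VP = (\<Union>p\<in>P. set p)"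
    define bad where "bad = {W. W \<subseteq> VP \<and> card W \<le> card P}"
    have finVP: "finite VP" unfolding VP_def using finP by simp
    have finbad: "finite bad" unfolding bad_def using finVP by simp
    have "\<forall>W\<in>bad. \<exists>p. walk E A B p \<and> set p \<inter> W = {}"
      using sep neg finVP unfolding bad_def separator_def
      by (metis (no_types, lifting) le_trans mem_Collect_eq rev_finite_subset)
    then obtain w where w: "\<And>W. W \<in> bad \<Longrightarrow> walk E A B (w W) \<and> set (w W) \<inter> W = {}" by metis
    define F where "F = (\<Union>p\<in>P \<union> w ` bad. set p)"
    define E' where "E' = (\<lambda>a b. E a b \<and> a \<in> F \<and> b \<in> F)"
    have finF: "finite F" unfolding F_def using finP finbad by simp
    have "finite {(a, b). E' a b}"
      by (rule finite_subset[of _ "F \<times> F"]) (auto simp: E'_def finF)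
    have E'E: "E' a b \<Longrightarrow> E a b" for a b unfolding E'_def by blast
    have link: "linkage E' A B P \<Longrightarrow> linkage E A B P" for P
      using linkage_mono[of E' A B P E] E'E by blast
    have walkE': "walk E' A B p" if "walk E A B p" "set p \<subseteq> F" for p
      using that unfolding walk_def E'_def by (auto elim!: successively_mono)
    \<comment> \<open>A linkage in \<open>E'\<close> is one in \<open>E\<close>, so it cannot exceed
      the maximum \<open>card P\<close>. The finite case then yields a separator \<open>W\<close> of
      at most this size.\<close>
    have "\<not> (\<exists>Q. linkage E' A B Q \<and> card Q = Suc (card P))"
      using Pmax link by (metis Suc_n_not_le_n)
    then obtain W where W: "finite W" "separator E' A B W" "card W \<le> card P"
      using menger_finite_edges[OF \<open>finite {(a, b). E' a b}\<close> fin, of "Suc (card P)"]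
      by (metis not_less_eq_eq)
    have "linkage E' A B P"
      using P walkE' unfolding linkage_def F_def by blast
    then obtain h where h: "inj_on h P" "\<And>p. p \<in> P \<Longrightarrow> h p \<in> set p \<inter> W"
      using linkage_separator_inj W by metis
    have "card (h ` P) = card P" using h(1) by (simp add: card_image)
    \<comment> \<open>\<open>P\<close> lies in \<open>E'\<close>, so \<open>W\<close> contains a
      vertex of each of its paths and, by its size, no other vertex. Thus \<open>W\<close> is a
      candidate in \<open>bad\<close> and is refuted by \<open>w W\<close>.\<close>
    then have "h ` P = W"
      using W h(2) by (metis IntD2 card_seteq image_subsetI)
    then have "W \<in> bad" using h(2) W(3) unfolding bad_def VP_def by blast
    then have "walk E' A B (w W)" using walkE'[of "w W"] w unfolding F_def by blast
    then show False using W(2) w[OF \<open>W \<in> bad\<close>] unfolding separator_def by blast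
  qed
  then obtain Q where Q: "Q \<subseteq> P" "card Q = k" by (meson obtain_subset_with_card_n)
  then have "linkage E A B Q" using P unfolding linkage_def by (meson finite_subset subsetD)
  then show ?thesis using Q by blast
qed

section \<open>Separations that efficiently distinguish tangles\<close>

lemma is_osep_swap: "graph V E \<Longrightarrow> is_osep V E A B \<Longrightarrow> is_osep V E B A"
  unfolding is_osep_def graph_def by blast

lemma is_separation_osep: "graph V E \<Longrightarrow> is_separation V E {A, B} \<longleftrightarrow> is_osep V E A B"
  unfolding is_separation_def by (metis doubleton_eq_iff is_osep_swap)

lemma orientations_pair: "orientations {A, B} = {(A, B), (B, A)}"
  unfolding orientations_def by (auto simp: doubleton_eq_iff)

text \<open>What the proof uses of an oriented separation \<open>(A, B)\<close> that efficiently distinguishes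
  two tangles: \<open>P\<close> lives in \<open>A\<close>, \<open>Q\<close> lives in \<open>B\<close>, and they agree below the order of \<open>{A, B}\<close>.\<close>

definition tangles_split_by :: "'v set \<Rightarrow> ('v \<Rightarrow> 'v \<Rightarrow> bool) \<Rightarrow> 'v set \<Rightarrow> 'v set \<Rightarrow>
    ('v set \<times> 'v set) set \<Rightarrow> ('v set \<times> 'v set) set \<Rightarrow> bool" where
  "tangles_split_by V E A B P Q \<longleftrightarrow>
     is_osep V E A B \<and> finite (A \<inter> B) \<and> tangle V E P \<and> tangle V E Q \<and>
     (B, A) \<in> P \<and> (A, B) \<in> Q \<and>
     (\<forall>C D. is_osep V E C D \<longrightarrow> finite (C \<inter> D) \<longrightarrow> card (C \<inter> D) < card (A \<inter> B) \<longrightarrow>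
        (C, D) \<in> P \<and> (C, D) \<in> Q \<or> (D, C) \<in> P \<and> (D, C) \<in> Q)"

text \<open>The bound \<open>k\<close> of the pre-tangle exceeds the order of any separation that it
  orients, hence all orders up to that one.\<close>

lemma pre_tangle_orients:
  assumes "pre_tangle V E P" "(A, B) \<in> P" "graph V E" "is_osep V E C D"
    "sep_order {C, D} \<le> sep_order {A, B}"
  shows "\<exists>p. P \<inter> orientations {C, D} = {p}"
proof -
  from assms(1) obtain k where
    "\<And>A B. (A, B) \<in> P \<Longrightarrow> sep_order {A, B} < k"
    "\<And>s. is_separation V E s \<and> sep_order s < k \<Longrightarrow> card (P \<inter> orientations s) = 1"
    unfolding pre_tangle_def by blast
  then have "card (P \<inter> orientations {C, D}) = 1"
    using assms is_separation_osep order_le_less_trans by metis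
  then show ?thesis by (simp add: card_1_singleton_iff)
qed

lemma eff_distinguishes_splits:
  assumes g: "graph V E" and P: "tangle V E P" and Q: "tangle V E Q"
    and eff: "eff_distinguishes V E {A, B} P Q"
  shows "\<exists>P Q. tangles_split_by V E A B P Q"
proof -
  have preP: "pre_tangle V E P" and preQ: "pre_tangle V E Q"
    using P Q unfolding tangle_def by auto
  have dist: "distinguishes V E {A, B} P Q" using eff unfolding eff_distinguishes_def by blast
  have osep: "is_osep V E A B"
    using dist is_separation_osep[OF g] unfolding distinguishes_def by blast
  have sym: "sep_order {B, A} = sep_order {A, B}" by (simp add: insert_commute)
  have P0: "(A, B) \<in> P \<or> (B, A) \<in> P" and Q0: "(A, B) \<in> Q \<or> (B, A) \<in> Q"
    using dist unfolding distinguishes_def orientations_pair by auto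
  \<comment> \<open>An element of \<open>enat\<close> strictly below another one is finite.\<close>
  have "\<exists>k. sep_order {A, B} < k" using P0 preP sym unfolding pre_tangle_def by metis
  then have fin: "finite (A \<inter> B)" unfolding sep_order_def by (auto split: if_splits)
  obtain p where p: "P \<inter> orientations {A, B} = {p}"
    using P0 pre_tangle_orients[OF preP _ g osep] sym by (metis order_refl)
  obtain q where q: "Q \<inter> orientations {A, B} = {q}"
    using Q0 pre_tangle_orients[OF preQ _ g osep] sym by (metis order_refl)
  have pq: "p \<noteq> q" using dist p q unfolding distinguishes_def by auto
  have agree: "(C, D) \<in> P \<and> (C, D) \<in> Q \<or> (D, C) \<in> P \<and> (D, C) \<in> Q"
    if CD: "is_osep V E C D" "finite (C \<inter> D)" "card (C \<inter> D) < card (A \<inter> B)" for C D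
  proof -
    have less: "sep_order {C, D} < sep_order {A, B}"
      using CD fin unfolding sep_order_def by auto
    obtain p' where p': "P \<inter> orientations {C, D} = {p'}"
      using P0 pre_tangle_orients[OF preP _ g CD(1)] sym less by (metis order_less_imp_le)
    obtain q' where q': "Q \<inter> orientations {C, D} = {q'}"
      using Q0 pre_tangle_orients[OF preQ _ g CD(1)] sym less by (metis order_less_imp_le)
    have "\<not> distinguishes V E {C, D} P Q"
      using eff less unfolding eff_distinguishes_def by (meson leD)
    then have "p' = q'"
      using p' q' CD(1) is_separation_osep[OF g] unfolding distinguishes_def by auto
    moreover have "p' \<in> P" "q' \<in> Q" "p' \<in> {(C, D), (D, C)}"
      using p' q' unfolding orientations_pair by auto
    ultimately show ?thesis by auto
  qed
  have "p \<in> {(A, B), (B, A)}" "q \<in> {(A, B), (B, A)}"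
    using p q unfolding orientations_pair by auto
  then have "(p = (B, A) \<and> q = (A, B)) \<or> (p = (A, B) \<and> q = (B, A))" using pq by auto
  moreover have "p \<in> P" "q \<in> Q" using p q by auto
  \<comment> \<open>Which of the two tangles lives in \<open>A\<close> is open, but their roles are
    symmetric.\<close>
  ultimately have "tangles_split_by V E A B P Q \<or> tangles_split_by V E A B Q P"
    using osep fin P Q agree unfolding tangles_split_by_def by blast
  then show ?thesis by blast
qed

text \<open>\<open>P\<close> contains \<open>(B, A)\<close>, so by consistency it cannot contain
  \<open>(D, C)\<close>. It contains \<open>(C, D)\<close> instead, and so does \<open>Q\<close>,
  since the tangles agree below the order of \<open>{A, B}\<close>. The smaller order also makes the
  two separations distinct, as consistency demands.\<close>

lemma tangles_split_by_below:
  assumes s: "tangles_split_by V E A B P Q" and CD: "is_osep V E C D" "finite (C \<inter> D)"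
    "card (C \<inter> D) < card (A \<inter> B)" and le: "C \<subseteq> B" "A \<subseteq> D"
  shows "(C, D) \<in> Q"
proof -
  have "{A, B} \<noteq> {C, D}"
  proof
    assume "{A, B} = {C, D}"
    then have "A \<inter> B = C \<inter> D" by (auto simp: doubleton_eq_iff)
    then show False using CD(3) by simp
  qed
  then have ne: "{B, A} \<noteq> {D, C}" by (metis insert_commute)
  have "consistent P" "(B, A) \<in> P"
    using s unfolding tangles_split_by_def tangle_def pre_tangle_def by auto
  moreover have "sep_le (A, B) (D, C)" using le unfolding sep_le_def by simp
  ultimately have "(D, C) \<notin> P" using ne unfolding consistent_def by blast
  then show ?thesis using s CD unfolding tangles_split_by_def by blast
qed

text \<open>Otherwise the corner \<open>(B \<inter> D, A \<union> C)\<close> has smaller order than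
  \<open>{A, B}\<close>: more than \<open>card (C \<inter> D)\<close> vertices of
  \<open>A \<inter> B\<close> are traded for at most that many of \<open>C \<inter> D\<close>. Then
  \<open>Q\<close> contains the corner, but \<open>A\<close>, \<open>C\<close> and
  \<open>B \<inter> D\<close> cover the graph.\<close>

lemma card_separator_side_le:
  assumes g: "graph V E" and s: "tangles_split_by V E A B P Q"
    and CD: "is_osep V E C D" "finite (C \<inter> D)" and Q: "(C, D) \<in> Q"
  shows "card (A \<inter> B \<inter> (C - D)) \<le> card (C \<inter> D)"
proof (rule ccontr)
  assume neg: "\<not> ?thesis"
  have AB: "is_osep V E A B" "finite (A \<inter> B)" using s unfolding tangles_split_by_def by auto
  have corner: "is_osep V E (B \<inter> D) (A \<union> C)"
    using AB(1) CD(1) g unfolding is_osep_def graph_def by blast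
  have eq: "(B \<inter> D) \<inter> (A \<union> C) = (A \<inter> B - (C - D)) \<union> (B \<inter> (C \<inter> D))"
    using CD(1) AB(1) unfolding is_osep_def by blast
  have fin: "finite ((B \<inter> D) \<inter> (A \<union> C))" unfolding eq using AB(2) CD(2) by blast
  have "card ((B \<inter> D) \<inter> (A \<union> C)) \<le> card (A \<inter> B - (C - D)) + card (B \<inter> (C \<inter> D))"
    unfolding eq by (rule card_Un_le)
  also have "card (B \<inter> (C \<inter> D)) \<le> card (C \<inter> D)" using CD(2) by (intro card_mono) auto
  also have "card (A \<inter> B - (C - D)) = card (A \<inter> B) - card (A \<inter> B \<inter> (C - D))"
    using AB(2) by (simp add: card_Diff_subset_Int)
  finally have "card ((B \<inter> D) \<inter> (A \<union> C)) \<le>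
      card (A \<inter> B) - card (A \<inter> B \<inter> (C - D)) + card (C \<inter> D)" by simp
  moreover have "card (A \<inter> B \<inter> (C - D)) \<le> card (A \<inter> B)"
    by (rule card_mono[OF AB(2)]) blast
  ultimately have "card ((B \<inter> D) \<inter> (A \<union> C)) < card (A \<inter> B)" using neg by linarith
  then have "(B \<inter> D, A \<union> C) \<in> Q"
    using tangles_split_by_below[OF s corner fin] by blast
  moreover have "(A, B) \<in> Q" "tangle V E Q" using s unfolding tangles_split_by_def by auto
  ultimately have "\<not> covers3 V E A C (B \<inter> D)" using Q unfolding tangle_def by blast
  moreover have "covers3 V E A C (B \<inter> D)"
    using AB(1) CD(1) g unfolding covers3_def is_osep_def graph_def by simp blast
  ultimately show False by blast
qed

lemma separator_unbalanced:
  assumes g: "graph V E" and s: "tangles_split_by V E A B P Q"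
    and CD: "is_osep V E C D" "finite (C \<inter> D)" "card (C \<inter> D) < card (A \<inter> B)"
  shows "card (A \<inter> B \<inter> (C - D)) \<le> card (C \<inter> D) \<or> card (A \<inter> B \<inter> (D - C)) \<le> card (C \<inter> D)"
proof -
  have "(C, D) \<in> Q \<or> (D, C) \<in> Q" using s CD unfolding tangles_split_by_def by blast
  then show ?thesis
    using card_separator_side_le[OF g s CD(1,2)]
      card_separator_side_le[OF g s is_osep_swap[OF g CD(1)]] CD(2)
    by (auto simp: Int_commute)
qed

lemma rtranclp_of_walk:
  assumes "xs \<noteq> []" "successively r xs"
  shows "r\<^sup>*\<^sup>* (hd xs) (last xs)"
  using assms
  by (induction xs rule: induct_list012) (auto intro: converse_rtranclp_into_rtranclp)

lemma rtranclp_connected: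
  assumes "connected_graph V E" "u \<in> V" "v \<in> V"
  shows "E\<^sup>*\<^sup>* u v"
  using assms rtranclp_of_walk
  unfolding connected_graph_def gpath_def successively_conv_nth[symmetric] by metis

lemma edge_leaving:
  assumes "connected_graph V E" "v \<in> V" "v \<in> K" "u \<in> V" "u \<notin> K"
  shows "\<exists>x y. E x y \<and> x \<in> K \<and> y \<notin> K"
proof -
  have "E\<^sup>*\<^sup>* v u" using rtranclp_connected assms by metis
  then show ?thesis using assms(3,5) by (induction rule: rtranclp_induct) auto
qed

section \<open>The limit of a strictly increasing chain of separations\<close>

locale separation_chain =
  fixes V :: "'v set" and E :: "'v \<Rightarrow> 'v \<Rightarrow> bool" and a b :: "nat \<Rightarrow> 'v set"
    and A B :: "'v set"
  assumes g: "graph V E" and conn: "connected_graph V E" and lf: "locally_finite V E"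
    and less: "\<And>i. sep_less (a i, b i) (a (Suc i), b (Suc i))"
    and split: "\<And>i. \<exists>P Q. tangles_split_by V E (a i) (b i) P Q"
    and A_def: "A = (\<Union>i. a i)" and B_def: "B = (\<Inter>i. b i)" and B_ne: "B \<noteq> {}"
begin

lemma osep: "is_osep V E (a i) (b i)" and finite_sep: "finite (a i \<inter> b i)"
  using split[of i] unfolding tangles_split_by_def by auto

lemma a_mono: "i \<le> j \<Longrightarrow> a i \<subseteq> a j"
  by (rule lift_Suc_mono_le[of a]) (use less in \<open>auto simp: sep_less_def sep_le_def\<close>)

lemma b_antimono: "i \<le> j \<Longrightarrow> b j \<subseteq> b i"
  by (rule lift_Suc_antimono_le[of b]) (use less in \<open>auto simp: sep_less_def sep_le_def\<close>)

lemma osep_limit: "is_osep V E A B"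
  unfolding is_osep_def
proof (intro conjI allI impI)
  show "A \<union> B = V" using osep unfolding A_def B_def is_osep_def by blast
next
  fix x y assume x: "x \<in> A - B" and y: "y \<in> B - A"
  obtain i j where "x \<in> a i" "x \<notin> b j" using x unfolding A_def B_def by blast
  then have "x \<in> a (max i j) - b (max i j)"
    using a_mono[of i "max i j"] b_antimono[of j "max i j"] by auto
  moreover have "y \<in> b (max i j) - a (max i j)" using y unfolding A_def B_def by blast
  ultimately show "\<not> E x y" using osep unfolding is_osep_def by blast
qed

lemma A_ne: "A \<noteq> {}"
proof
  assume "A = {}"
  then have e: "a i = {}" for i unfolding A_def by blast
  then have "b i = V" for i using osep[of i] unfolding is_osep_def by simp
  then show False using less[of 0] e unfolding sep_less_def by simp
qed

lemma limit_subset_V: "A \<inter> B \<subseteq> V"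
  using osep_limit unfolding is_osep_def by blast

text \<open>If \<open>B\<close> is not all of \<open>V\<close>, connectedness gives an edge leaving
  \<open>B\<close>. Its end in \<open>B\<close> lies in \<open>A\<close> as well, because
  \<open>(A, B)\<close> is a separation.\<close>

lemma limit_ne: "A \<inter> B \<noteq> {}"
proof (cases "B = V")
  case True
  then show ?thesis using A_ne osep_limit unfolding is_osep_def by blast
next
  case False
  obtain v u where vu: "v \<in> B" "u \<in> V - B"
    using False B_ne osep_limit unfolding is_osep_def by blast
  then have "v \<in> V" using osep_limit unfolding is_osep_def by blast
  then obtain x y where "E x y" "x \<in> B" "y \<notin> B" using edge_leaving[OF conn, of v B u] vu by blast
  then show ?thesis using osep_limit g unfolding is_osep_def graph_def by blast
qed

lemma finite_subset_limit:
  assumes "finite F" "F \<subseteq> A \<inter> B"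
  shows "\<exists>j. \<forall>i\<ge>j. F \<subseteq> a i \<inter> b i"
  using assms
proof (induction F rule: finite_induct)
  case (insert x F)
  then obtain j where j: "\<forall>i\<ge>j. F \<subseteq> a i \<inter> b i" by blast
  obtain k where "x \<in> a k" using insert.prems unfolding A_def by blast
  then have "\<forall>i\<ge>max j k. insert x F \<subseteq> a i \<inter> b i"
    using j insert.prems a_mono[of k] unfolding B_def by fastforce
  then show ?case by blast
qed auto

lemma finite_avoids:
  assumes "finite F" "F \<inter> B = {}"
  shows "\<exists>j. \<forall>i\<ge>j. F \<inter> b i = {}"
  using assms
proof (induction F rule: finite_induct)
  case (insert x F)
  then obtain j where j: "\<forall>i\<ge>j. F \<inter> b i = {}" by blast
  obtain k where "x \<notin> b k" using insert.prems unfolding B_def by blast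
  then have "\<forall>i\<ge>max j k. insert x F \<inter> b i = {}"
    using j b_antimono[of k] by fastforce
  then show ?case by blast
qed auto

text \<open>If the limit separator \<open>A \<inter> B\<close> were finite, then deleting \<open>B\<close> from \<open>b j\<close> would for large \<open>j\<close>
  yield a separation of smaller order, and the tangle living in \<open>b j\<close> would have nowhere to live.\<close>

lemma infinite_limit: "infinite (A \<inter> B)"
proof
  assume fin: "finite (A \<inter> B)"
  \<comment> \<open>\<open>M\<close> is finite by local finiteness and disjoint from
    \<open>B\<close>, so it misses \<open>b j\<close> for large \<open>j\<close>. From then on no
    edge joins \<open>B\<close> to \<open>b j - B\<close>.\<close>
  define M where "M = {w \<in> A - B. \<exists>x\<in>A \<inter> B. E x w}"
  have "M \<subseteq> (\<Union>x\<in>A \<inter> B. {w. E x w})" unfolding M_def by blast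
  moreover have "finite (\<Union>x\<in>A \<inter> B. {w. E x w})"
    using fin lf limit_subset_V unfolding locally_finite_def by blast
  ultimately have "finite M" by (rule finite_subset)
  moreover have "M \<inter> B = {}" unfolding M_def by blast
  ultimately obtain j1 where j1: "\<forall>i\<ge>j1. M \<inter> b i = {}" using finite_avoids by metis
  obtain j2 where j2: "\<forall>i\<ge>j2. A \<inter> B \<subseteq> a i \<inter> b i" using finite_subset_limit[OF fin] by blast
  define j where "j = max j1 j2"
  have Mj: "M \<inter> b j = {}" and Xj: "A \<inter> B \<subseteq> a j \<inter> b j" using j1 j2 unfolding j_def by auto
  have aA: "a j \<subseteq> A" and Bb: "B \<subseteq> b j" unfolding A_def B_def by auto
  have AB: "is_osep V E A B" by (rule osep_limit)
  have sym: "E x y \<Longrightarrow> E y x" for x y using g unfolding graph_def by blast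
  have inV: "E x y \<Longrightarrow> x \<in> A \<union> B \<and> y \<in> A \<union> B" for x y
    using g AB unfolding graph_def is_osep_def by blast
  have noedge: "\<not> E x y" if x: "x \<in> B" and y: "y \<in> b j - B" for x y
  proof
    assume e: "E x y"
    then have yA: "y \<in> A - B" using inV y by blast
    then have "x \<in> A" using AB sym[OF e] x unfolding is_osep_def by blast
    then have "y \<in> M" using x yA e unfolding M_def by blast
    then show False using Mj y by blast
  qed
  have rest: "is_osep V E (b j - B) (a j \<union> B)"
    using osep[of j] noedge sym Bb unfolding is_osep_def by blast
  have eq: "(b j - B) \<inter> (a j \<union> B) = (a j \<inter> b j) - (A \<inter> B)" using aA by blast
  have cardrest: "card ((b j - B) \<inter> (a j \<union> B)) < card (a j \<inter> b j)"
    unfolding eq using finite_sep[of j] Xj limit_ne by (intro psubset_card_mono) auto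
  obtain P Q where s: "tangles_split_by V E (a j) (b j) P Q" using split by blast
  have restQ: "(b j - B, a j \<union> B) \<in> Q"
    by (rule tangles_split_by_below[OF s rest _ cardrest]) (auto simp: eq finite_sep)
  show False
  proof (cases "A \<inter> B = a j \<inter> b j")
    case True
    \<comment> \<open>The separation \<open>rest\<close> now has order 0, so connectedness and
      \<open>B \<noteq> {}\<close> leave \<open>b j - B\<close> empty. Then
      \<open>(a j, b j)\<close> equals its successor, against strictness.\<close>
    have "b j = B"
    proof (rule ccontr)
      assume "b j \<noteq> B"
      then obtain v u where vu: "v \<in> b j - B" "u \<in> B" using Bb B_ne by blast
      then have "v \<in> V" "u \<in> V" using osep[of j] Bb unfolding is_osep_def by auto
      then obtain x y where "E x y" "x \<in> b j - B" "y \<notin> b j - B"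
        using edge_leaving[OF conn, of v "b j - B" u] vu by blast
      moreover have "(b j - B) \<inter> (a j \<union> B) = {}" using eq True by blast
      moreover have "y \<in> V" using \<open>E x y\<close> g unfolding graph_def by blast
      ultimately show False using rest unfolding is_osep_def by blast
    qed
    moreover have "B \<subseteq> b (Suc j)" unfolding B_def by auto
    moreover have "b (Suc j) \<subseteq> b j" using b_antimono[of j "Suc j"] by simp
    moreover have "a (Suc j) \<subseteq> a j"
    proof
      fix x assume x: "x \<in> a (Suc j)"
      then have "x \<in> A" unfolding A_def by blast
      then show "x \<in> a j"
        using Xj \<open>b j = B\<close> osep[of j] AB unfolding is_osep_def by blast
    qed
    ultimately show False
      using less[of j] a_mono[of j "Suc j"] unfolding sep_less_def by auto
  next
    case False
    \<comment> \<open>Now \<open>{B, A}\<close> has smaller order than \<open>{a j, b j}\<close>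
      too, so \<open>Q\<close> contains \<open>(B, A)\<close>. But \<open>a j\<close>,
      \<open>B\<close> and \<open>b j - B\<close> cover the graph, as an edge inside
      \<open>b j\<close> cannot join \<open>B\<close> to \<open>b j - B\<close>.\<close>
    then have "card (B \<inter> A) < card (a j \<inter> b j)"
      using Xj finite_sep[of j] by (intro psubset_card_mono) auto
    then have "(B, A) \<in> Q"
      using tangles_split_by_below[OF s is_osep_swap[OF g AB]] fin aA Bb by (simp add: Int_commute)
    moreover have "(a j, b j) \<in> Q" "tangle V E Q" using s unfolding tangles_split_by_def by auto
    ultimately have "\<not> covers3 V E (a j) B (b j - B)" using restQ unfolding tangle_def by blast
    moreover have "covers3 V E (a j) B (b j - B)"
    proof -
      have "\<exists>Ai\<in>{a j, B, b j - B}. x \<in> Ai \<and> y \<in> Ai" if e: "E x y" for x y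
      proof -
        have V: "x \<in> a j \<union> b j" "y \<in> a j \<union> b j"
          using e g osep[of j] unfolding graph_def is_osep_def by auto
        have "\<not> (x \<in> a j - b j \<and> y \<in> b j - a j)" "\<not> (y \<in> a j - b j \<and> x \<in> b j - a j)"
          using osep[of j] e sym[OF e] unfolding is_osep_def by auto
        then have "x \<in> a j \<and> y \<in> a j \<or> x \<in> b j \<and> y \<in> b j" using V by blast
        then show ?thesis using noedge[of x y] noedge[of y x] e sym[OF e] by auto
      qed
      moreover have "a j \<subseteq> V" "B \<subseteq> V" "b j - B \<subseteq> V" "a j \<union> B \<union> (b j - B) = V"
        using osep[of j] AB unfolding is_osep_def by auto
      ultimately show ?thesis unfolding covers3_def by simp
    qed
    ultimately show False by blast
  qed
qed

text \<open>If both sides held too many vertices of \<open>A \<inter> B\<close>, finitely many of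
  them would witness this. They all lie in one late \<open>a j \<inter> b j\<close>, against
  \<open>separator_unbalanced\<close>.\<close>

lemma limit_unbalanced:
  assumes CD: "is_osep V E C D" "finite (C \<inter> D)"
  shows "finite (A \<inter> B \<inter> (C - D)) \<and> card (A \<inter> B \<inter> (C - D)) \<le> card (C \<inter> D) \<or>
    finite (A \<inter> B \<inter> (D - C)) \<and> card (A \<inter> B \<inter> (D - C)) \<le> card (C \<inter> D)"
proof (rule ccontr)
  assume neg: "\<not> ?thesis"
  let ?k = "Suc (card (C \<inter> D))"
  have sub: "\<exists>F. finite F \<and> F \<subseteq> S \<and> card F = ?k"
    if "\<not> (finite S \<and> card S \<le> card (C \<inter> D))" for S :: "'v set"
    using that by (metis infinite_arbitrarily_large not_less_eq_eq obtain_subset_with_card_n)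
  obtain F where F: "finite F" "F \<subseteq> A \<inter> B \<inter> (C - D)" "card F = ?k" using sub neg by blast
  obtain F' where F': "finite F'" "F' \<subseteq> A \<inter> B \<inter> (D - C)" "card F' = ?k" using sub neg by blast
  obtain j where j: "F \<union> F' \<subseteq> a j \<inter> b j"
    using finite_subset_limit[of "F \<union> F'"] F F' by blast
  obtain P Q where s: "tangles_split_by V E (a j) (b j) P Q" using split by blast
  have "?k \<le> card (a j \<inter> b j)"
    using card_mono[OF finite_sep[of j], of F] j F(3) by simp
  then have "card (a j \<inter> b j \<inter> (C - D)) \<le> card (C \<inter> D) \<or>
      card (a j \<inter> b j \<inter> (D - C)) \<le> card (C \<inter> D)"
    using separator_unbalanced[OF g s CD] by simp
  moreover have "?k \<le> card (a j \<inter> b j \<inter> (C - D))"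
    unfolding F(3)[symmetric] using F(2) j finite_sep[of j] by (intro card_mono) auto
  moreover have "?k \<le> card (a j \<inter> b j \<inter> (D - C))"
    unfolding F'(3)[symmetric] using F'(2) j finite_sep[of j] by (intro card_mono) auto
  ultimately show False by linarith
qed

end

section \<open>Reachability and rays\<close>

text \<open>A step to a vertex already visited truncates the path there. The bound on
  \<open>set xs\<close> passes what \<open>r\<close> imposes on its targets to all vertices but the
  first.\<close>

lemma path_of_rtranclp:
  assumes "r\<^sup>*\<^sup>* u v"
  shows "\<exists>xs. xs \<noteq> [] \<and> distinct xs \<and> successively r xs \<and> hd xs = u \<and> last xs = v \<and>
    set xs \<subseteq> insert u {y. \<exists>x. r x y}"
  using assms
proof (induction rule: rtranclp_induct)
  case base
  show ?case by (rule exI[of _ "[u]"]) auto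
next
  case (step y z)
  then obtain xs where xs: "xs \<noteq> []" "distinct xs" "successively r xs" "hd xs = u" "last xs = y"
    "set xs \<subseteq> insert u {y. \<exists>x. r x y}" by blast
  show ?case
  proof (cases "z \<in> set xs")
    case True
    then obtain ys zs where "xs = ys @ z # zs" by (meson split_list)
    then show ?thesis using xs
      by (intro exI[of _ "ys @ [z]"]) (auto simp: successively_append_iff hd_append)
  next
    case False
    then show ?thesis using xs step.hyps(2)
      by (intro exI[of _ "xs @ [z]"]) (auto simp: successively_append_iff)
  qed
qed

text \<open>Reflexive at every vertex, even in \<open>X\<close>; hence the extra condition on
  \<open>u\<close> in \<open>connected_avoiding_iff\<close>.\<close>

definition reach :: "('v \<Rightarrow> 'v \<Rightarrow> bool) \<Rightarrow> 'v set \<Rightarrow> 'v \<Rightarrow> 'v \<Rightarrow> bool" where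
  "reach E X = (\<lambda>a b. E a b \<and> a \<notin> X \<and> b \<notin> X)\<^sup>*\<^sup>*"

lemma reach_refl: "reach E X v v"
  unfolding reach_def by simp

lemma reach_trans: "reach E X u v \<Longrightarrow> reach E X v w \<Longrightarrow> reach E X u w"
  unfolding reach_def by (rule rtranclp_trans)

lemma reach_edge: "reach E X u v \<Longrightarrow> E v w \<Longrightarrow> v \<notin> X \<Longrightarrow> w \<notin> X \<Longrightarrow> reach E X u w"
  unfolding reach_def by (rule rtranclp.rtrancl_into_rtrancl) auto

lemma reach_induct [consumes 1, case_names base step]:
  assumes "reach E X u v" "P u"
    and "\<And>y z. reach E X u y \<Longrightarrow> E y z \<Longrightarrow> y \<notin> X \<Longrightarrow> z \<notin> X \<Longrightarrow> P y \<Longrightarrow> P z"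
  shows "P v"
  using assms(1)[unfolded reach_def] assms(2)
  by (induction rule: rtranclp_induct) (use assms(3) in \<open>auto simp: reach_def\<close>)

lemma reach_sym:
  assumes "graph V E" "reach E X u v"
  shows "reach E X v u"
  using assms(2)
proof (induction rule: reach_induct)
  case base
  show ?case by (rule reach_refl)
next
  case (step y z)
  then have "reach E X z y"
    using reach_edge[OF reach_refl, of E z y X] assms(1) unfolding graph_def by blast
  then show ?case using step.IH by (rule reach_trans)
qed

lemma reach_notin: "reach E X u v \<Longrightarrow> u \<notin> X \<Longrightarrow> v \<notin> X"
  by (induction rule: reach_induct) auto

lemma reach_in_V: "reach E X u v \<Longrightarrow> graph V E \<Longrightarrow> u \<in> V \<Longrightarrow> v \<in> V"
  by (induction rule: reach_induct) (auto simp: graph_def)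

lemma reach_of_walk:
  assumes "xs \<noteq> []" "successively E xs" "set xs \<inter> X = {}"
  shows "reach E X (hd xs) (last xs)"
proof -
  have "successively (\<lambda>a b. E a b \<and> a \<notin> X \<and> b \<notin> X) xs"
    using assms(2,3) by (auto elim!: successively_mono)
  then show ?thesis unfolding reach_def using assms(1) by (rule rtranclp_of_walk[rotated])
qed

lemma gpath_iff: "gpath V E xs \<longleftrightarrow> xs \<noteq> [] \<and> distinct xs \<and> set xs \<subseteq> V \<and> successively E xs"
  unfolding gpath_def successively_conv_nth by blast

lemma gpath_of_reach:
  assumes "graph V E" "u \<in> V" "u \<notin> X" "reach E X u v"
  obtains xs where "gpath V E xs" "hd xs = u" "last xs = v" "set xs \<inter> X = {}"
proof -
  obtain xs where xs: "xs \<noteq> []" "distinct xs" "successively (\<lambda>a b. E a b \<and> a \<notin> X \<and> b \<notin> X) xs"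
    "hd xs = u" "last xs = v" "set xs \<subseteq> insert u {y. \<exists>x. E x y \<and> x \<notin> X \<and> y \<notin> X}"
    using path_of_rtranclp[OF assms(4)[unfolded reach_def]] by blast
  have "successively E xs" using xs(3) by (auto elim!: successively_mono)
  moreover have "set xs \<subseteq> V" "set xs \<inter> X = {}"
    using xs(6) assms(1-3) unfolding graph_def by auto
  ultimately show ?thesis using that xs unfolding gpath_iff by blast
qed

lemma connected_avoiding_iff:
  assumes "graph V E"
  shows "connected_avoiding V E X u v \<longleftrightarrow> u \<in> V \<and> u \<notin> X \<and> reach E X u v"
proof
  assume "connected_avoiding V E X u v"
  then obtain xs where xs: "gpath V E xs" "hd xs = u" "last xs = v" "set xs \<inter> X = {}"
    unfolding connected_avoiding_def by blast
  then have "u \<in> set xs" unfolding gpath_iff by auto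
  then show "u \<in> V \<and> u \<notin> X \<and> reach E X u v"
    using xs reach_of_walk[of xs E X] unfolding gpath_iff by blast
next
  assume "u \<in> V \<and> u \<notin> X \<and> reach E X u v"
  then show "connected_avoiding V E X u v"
    using gpath_of_reach[OF assms] unfolding connected_avoiding_def by metis
qed

lemma ray_tail_avoids:
  assumes "ray V E R" "finite X"
  shows "\<exists>n. \<forall>k\<ge>n. R k \<notin> X"
proof -
  have "finite (R -` X)" using assms unfolding ray_def by (intro finite_vimageI) auto
  then obtain n where "\<forall>k\<in>R -` X. k < n" using finite_nat_set_iff_bounded by blast
  then show ?thesis by (intro exI[of _ n]) (metis leD vimageI2)
qed

lemma reach_ray_tail:
  assumes "graph V E" "ray V E R" "\<forall>k\<ge>n. R k \<notin> X" "n \<le> i" "n \<le> j"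
  shows "reach E X (R i) (R j)"
proof -
  have "reach E X (R n) (R k)" if "n \<le> k" for k
    using that
  proof (induction k rule: dec_induct)
    case base
    show ?case by (rule reach_refl)
  next
    case (step k)
    then show ?case using reach_edge[of E X "R n" "R k" "R (Suc k)"] assms(2,3)
      unfolding ray_def by auto
  qed
  then show ?thesis using assms(4,5) reach_trans reach_sym[OF assms(1)] by metis
qed

lemma ray_equiv_sym:
  assumes "graph V E" "ray_equiv V E R R'"
  shows "ray_equiv V E R' R"
proof -
  have "\<exists>n m. (\<forall>k\<ge>n. R' k \<notin> X) \<and> (\<forall>k\<ge>m. R k \<notin> X) \<and> connected_avoiding V E X (R' n) (R m)"
    if "finite X" for X
  proof -
    obtain n m where nm: "\<forall>k\<ge>n. R k \<notin> X" "\<forall>k\<ge>m. R' k \<notin> X" "connected_avoiding V E X (R n) (R' m)"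
      using assms(2) \<open>finite X\<close> unfolding ray_equiv_def by blast
    then have "connected_avoiding V E X (R' m) (R n)"
      unfolding connected_avoiding_iff[OF assms(1)]
      using reach_sym[OF assms(1)] reach_in_V[OF _ assms(1)] by blast
    then show ?thesis using nm by blast
  qed
  then show ?thesis using assms(2) unfolding ray_equiv_def by blast
qed

lemma ray_equiv_trans:
  assumes g: "graph V E" and "ray_equiv V E R R'" "ray_equiv V E R' R''"
  shows "ray_equiv V E R R''"
proof -
  have "\<exists>n m. (\<forall>k\<ge>n. R k \<notin> X) \<and> (\<forall>k\<ge>m. R'' k \<notin> X) \<and> connected_avoiding V E X (R n) (R'' m)"
    if fin: "finite X" for X
  proof -
    obtain n m where nm: "\<forall>k\<ge>n. R k \<notin> X" "\<forall>k\<ge>m. R' k \<notin> X" "connected_avoiding V E X (R n) (R' m)"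
      using assms(2) fin unfolding ray_equiv_def by blast
    obtain n' m' where nm': "\<forall>k\<ge>n'. R' k \<notin> X" "\<forall>k\<ge>m'. R'' k \<notin> X"
        "connected_avoiding V E X (R' n') (R'' m')"
      using assms(3) fin unfolding ray_equiv_def by blast
    have R': "ray V E R'" using assms(2) unfolding ray_equiv_def by blast
    \<comment> \<open>The two connections end at different places of \<open>R'\<close>; they are
      joined along a segment of its tail that avoids \<open>X\<close>.\<close>
    have "\<forall>k\<ge>min m n'. R' k \<notin> X" using nm(2) nm'(1) by (simp add: min_le_iff_disj)
    then have "reach E X (R' m) (R' n')" by (rule reach_ray_tail[OF g R']) auto
    then have "connected_avoiding V E X (R n) (R'' m')"
      using nm(3) nm'(3) unfolding connected_avoiding_iff[OF g] by (blast intro: reach_trans)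
    then show ?thesis using nm nm' by blast
  qed
  then show ?thesis using assms unfolding ray_equiv_def by blast
qed

text \<open>Greedy choice: each list avoids the union \<open>F n\<close> of all earlier ones.
  Disjoint nonempty lists are distinct.\<close>

lemma infinite_disjoint_lists:
  assumes "\<And>S. finite S \<Longrightarrow> \<exists>p. Q p \<and> p \<noteq> [] \<and> set p \<inter> S = {}"
  shows "\<exists>Ps. infinite Ps \<and> (\<forall>p\<in>Ps. Q p) \<and> (\<forall>p\<in>Ps. \<forall>q\<in>Ps. p \<noteq> q \<longrightarrow> set p \<inter> set q = {})"
proof -
  obtain c where c: "\<And>S. finite S \<Longrightarrow> Q (c S) \<and> c S \<noteq> [] \<and> set (c S) \<inter> S = {}"
    using assms by metis
  define F where "F = rec_nat {} (\<lambda>_ S. S \<union> set (c S))"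
  have F_Suc: "F (Suc n) = F n \<union> set (c (F n))" for n unfolding F_def by simp
  have fin: "finite (F n)" for n by (induction n) (simp_all add: F_Suc, simp add: F_def)
  have mono: "m \<le> n \<Longrightarrow> F m \<subseteq> F n" for m n by (rule lift_Suc_mono_le[of F]) (auto simp: F_Suc)
  have disj: "set (c (F m)) \<inter> set (c (F n)) = {}" if "m < n" for m n
    using mono[of "Suc m" n] c[OF fin[of n]] that F_Suc[of m] by auto
  then have disj': "set (c (F m)) \<inter> set (c (F n)) = {}" if "m \<noteq> n" for m n
    using that by (metis Int_commute nat_neq_iff)
  have "inj (\<lambda>n. c (F n))"
    by (rule injI) (metis disj' c[OF fin] Int_absorb set_empty)
  then have "infinite (range (\<lambda>n. c (F n)))" by (rule range_inj_infinite)
  moreover have "\<forall>p\<in>range (\<lambda>n. c (F n)). Q p" using c[OF fin] by blast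
  moreover have "\<forall>p\<in>range (\<lambda>n. c (F n)). \<forall>q\<in>range (\<lambda>n. c (F n)). p \<noteq> q \<longrightarrow> set p \<inter> set q = {}"
  proof (intro ballI impI)
    fix p q assume "p \<in> range (\<lambda>n. c (F n))" "q \<in> range (\<lambda>n. c (F n))" "p \<noteq> q"
    then obtain m n where "p = c (F m)" "q = c (F n)" "m \<noteq> n" by blast
    then show "set p \<inter> set q = {}" using disj' by simp
  qed
  ultimately show ?thesis by blast
qed

text \<open>Appending the head of the next block covers the edges inside a block and the edge to its
  successor at once.\<close>

lemma ray_of_blocks:
  assumes ne: "\<And>i. D i \<noteq> []" and dist: "\<And>i. distinct (D i)"
    and disj: "\<And>i j. i \<noteq> j \<Longrightarrow> set (D i) \<inter> set (D j) = {}"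
    and V: "\<And>i. set (D i) \<subseteq> V" and succ: "\<And>i. successively E (D i @ [hd (D (Suc i))])"
  obtains R where "ray V E R" "range R \<subseteq> (\<Union>i. set (D i))"
proof -
  define W where "W n = concat (map D [0..<n])" for n
  have W_Suc: "W (Suc n) = W n @ D n" for n unfolding W_def by simp
  have setW: "set (W n) = (\<Union>i<n. set (D i))" for n unfolding W_def by auto
  have len: "n \<le> length (W n)" for n
  proof (induction n)
    case (Suc n)
    then show ?case using ne[of n] unfolding W_Suc by (cases "D n") auto
  qed simp
  have prefix: "\<exists>ys. W m = W n @ ys" if "n \<le> m" for n m
    using that by (induction m rule: dec_induct) (auto simp: W_Suc)
  \<comment> \<open>Blocks are nonempty, so \<open>W (Suc k)\<close> has a position
    \<open>k\<close>. As the \<open>W n\<close> extend one another, any long enough one gives the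
    same entry.\<close>
  define R where "R k = W (Suc k) ! k" for k
  have R: "R k = W n ! k" if "k < length (W n)" for k n
  proof -
    have k: "k < length (W (Suc k))" using len[of "Suc k"] by simp
    show ?thesis
      using prefix[of n "Suc k"] prefix[of "Suc k" n] that k unfolding R_def
      by (metis nat_le_linear nth_append)
  qed
  have distW: "distinct (W n)" for n
  proof (induction n)
    case (Suc n)
    have "set (D i) \<inter> set (D n) = {}" if "i < n" for i using disj[of i n] that by simp
    then have "set (W n) \<inter> set (D n) = {}" unfolding setW by blast
    then show ?case using Suc dist unfolding W_Suc by simp
  qed (simp add: W_def)
  have sucW: "successively E (W n @ [hd (D n)])" for n
  proof (induction n)
    case (Suc n)
    have "W n @ D n @ [hd (D (Suc n))] = W n @ hd (D n) # tl (D n) @ [hd (D (Suc n))]"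
      using ne[of n] by simp
    then show ?case
      using Suc succ[of n] ne[of n] unfolding W_Suc
      by (auto simp: successively_append_iff)
  qed (simp add: W_def)
  have "inj R"
  proof (rule linorder_injI)
    fix k l :: nat assume "k < l"
    moreover have "Suc l \<le> length (W (Suc l))" by (rule len)
    ultimately show "R k \<noteq> R l"
      using R[of k "Suc l"] R[of l "Suc l"] distW[of "Suc l"] by (simp add: nth_eq_iff_index_eq)
  qed
  moreover have "E (R k) (R (Suc k))" for k
  proof -
    have l: "Suc k < length (W (Suc (Suc k)))" using len[of "Suc (Suc k)"] by simp
    have "successively E (W (Suc (Suc k)))" using sucW successively_append_iff by blast
    then show ?thesis using successively_nth[OF _ l] R[of k] R[of "Suc k"] l by (metis Suc_lessD)
  qed
  moreover have sub: "range R \<subseteq> (\<Union>i. set (D i))"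
  proof
    fix x assume "x \<in> range R"
    then obtain k where "x = W (Suc k) ! k" unfolding R_def by blast
    then have "x \<in> set (W (Suc k))" using len[of "Suc k"] by (simp add: nth_mem)
    then show "x \<in> (\<Union>i. set (D i))" unfolding setW by blast
  qed
  moreover have "range R \<subseteq> V" using sub V by blast
  ultimately show ?thesis using that unfolding ray_def by blast
qed

section \<open>Sets that no finite separator splits evenly\<close>

locale concentrated_set =
  fixes V :: "'v set" and E :: "'v \<Rightarrow> 'v \<Rightarrow> bool" and U :: "'v set"
  assumes g: "graph V E" and conn: "connected_graph V E" and lf: "locally_finite V E"
    and U_sub: "U \<subseteq> V" and U_inf: "infinite U"
    and unbalanced: "\<And>C D. is_osep V E C D \<Longrightarrow> finite (C \<inter> D) \<Longrightarrow>
      finite (U \<inter> (C - D)) \<and> card (U \<inter> (C - D)) \<le> card (C \<inter> D) \<or>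
      finite (U \<inter> (D - C)) \<and> card (U \<inter> (D - C)) \<le> card (C \<inter> D)"
begin

text \<open>The union of the components of \<open>G - X\<close> that contain infinitely many
  vertices of \<open>U\<close>; for finite \<open>X\<close> it turns out to be a single
  component.\<close>

definition major :: "'v set \<Rightarrow> 'v set" where
  "major X = {v \<in> V - X. infinite {u \<in> U. reach E X v u}}"

lemma edge_sym: "E x y \<Longrightarrow> E y x" and edge_in_V: "E x y \<Longrightarrow> x \<in> V \<and> y \<in> V"
  using g unfolding graph_def by auto

lemma finite_neighbours: "finite {w. E v w}"
proof (cases "v \<in> V")
  case True
  then show ?thesis using lf unfolding locally_finite_def by blast
next
  case False
  then have "{w. E v w} = {}" using edge_in_V by blast
  then show ?thesis by simp
qed

lemma major_sub: "major X \<subseteq> V - X"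
  unfolding major_def by blast

lemma major_closed:
  assumes "v \<in> major X" "reach E X v w"
  shows "w \<in> major X"
proof -
  have "{u \<in> U. reach E X v u} \<subseteq> {u \<in> U. reach E X w u}"
    using reach_trans[OF reach_sym[OF g assms(2)]] by blast
  then have "infinite {u \<in> U. reach E X w u}"
    using assms(1) unfolding major_def by (auto dest: finite_subset)
  moreover have "w \<in> V - X"
    using assms reach_notin[OF assms(2)] reach_in_V[OF assms(2) g] unfolding major_def by blast
  ultimately show ?thesis unfolding major_def by blast
qed

lemma major_boundary:
  assumes "E w v" "v \<in> major X" "w \<notin> major X"
  shows "w \<in> X"
proof (rule ccontr)
  assume "w \<notin> X"
  moreover have "v \<notin> X" using assms(2) major_sub by blast
  ultimately have "reach E X v w"
    using reach_edge[of E X v v w] reach_refl[of E X v] edge_sym[OF assms(1)] by blast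
  then show False using major_closed assms(2,3) by blast
qed

text \<open>A walk from \<open>v0\<close> to a vertex outside \<open>X\<close> has a last segment in
  \<open>G - X\<close> that starts at \<open>v0\<close> or at a neighbour of \<open>X\<close>. These
  starting points form the finite set \<open>T\<close>, and one of them reaches infinitely many
  vertices of \<open>U\<close>.\<close>

lemma major_ne:
  assumes "finite X"
  shows "major X \<noteq> {}"
proof -
  obtain v0 where v0: "v0 \<in> U" using U_inf by fastforce
  define T where "T = ((\<Union>x\<in>X. {w. E x w}) \<union> {v0}) - X"
  have T: "finite T" "T \<subseteq> V"
    using assms finite_neighbours edge_in_V v0 U_sub unfolding T_def by auto
  have "\<exists>t\<in>T. reach E X t u" if "u \<in> V" "u \<notin> X" for u
  proof -
    have "E\<^sup>*\<^sup>* v0 u" using rtranclp_connected[OF conn] v0 U_sub that by blast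
    then show ?thesis using that(2)
    proof (induction rule: rtranclp_induct)
      case base
      then show ?case unfolding T_def by (auto intro: reach_refl)
    next
      case (step y z)
      show ?case
      proof (cases "y \<in> X")
        case True
        then have "z \<in> T" using step unfolding T_def by blast
        then show ?thesis using reach_refl by metis
      next
        case False
        then show ?thesis using step reach_edge by metis
      qed
    qed
  qed
  then have "U - X \<subseteq> (\<Union>t\<in>T. {u \<in> U. reach E X t u})" using U_sub by blast
  moreover have "infinite (U - X)" using U_inf assms by (simp add: Diff_infinite_finite)
  ultimately have "infinite (\<Union>t\<in>T. {u \<in> U. reach E X t u})" using finite_subset by blast
  then obtain t where "t \<in> T" "infinite {u \<in> U. reach E X t u}" using T(1) by blast
  then show ?thesis using T(2) unfolding major_def T_def by blast
qed

text \<open>For a component \<open>K\<close> in \<open>major X\<close>, the separation with sides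
  \<open>K \<union> (X \<inter> V)\<close> and \<open>V - K\<close> has order at most
  \<open>card X\<close>. The side of \<open>K\<close> contains infinitely many vertices of
  \<open>U\<close>, so the other side contains at most \<open>card X\<close> of them outside
  \<open>X\<close>.\<close>

lemma
  assumes X: "finite X"
  shows major_connected: "v \<in> major X \<Longrightarrow> w \<in> major X \<Longrightarrow> reach E X v w"
    and finite_outside_major: "finite (U - major X)"
    and card_outside_major: "card (U - major X - X) \<le> card X"
proof -
  obtain v where v: "v \<in> major X" using major_ne[OF X] by blast
  define K where "K = {w. reach E X v w}"
  have K: "K \<subseteq> major X" unfolding K_def using major_closed[OF v] by blast
  have KV: "K \<subseteq> V - X" using K major_sub by blast
  define C where "C = K \<union> (X \<inter> V)"
  define D where "D = V - K"
  have "\<not> E x y" if "x \<in> C - D" "y \<in> D - C" for x y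
  proof
    assume e: "E x y"
    have "x \<in> K" "y \<notin> K" "y \<notin> X" using that KV unfolding C_def D_def by auto
    then show False using e reach_edge[of E X v x y] KV unfolding K_def by blast
  qed
  then have sep: "is_osep V E C D" using KV unfolding is_osep_def C_def D_def by blast
  have CD: "C \<inter> D = X \<inter> V" "C - D = K" "D - C = V - K - X" using KV unfolding C_def D_def by auto
  have "infinite (U \<inter> K)"
    using v unfolding major_def K_def by (simp add: Int_def)
  then have small: "finite (U \<inter> (V - K - X))" "card (U \<inter> (V - K - X)) \<le> card (X \<inter> V)"
    using unbalanced[OF sep] X unfolding CD by auto
  \<comment> \<open>Only finitely many vertices of \<open>U\<close> lie outside
    \<open>K \<union> X\<close>, so the component of \<open>w\<close> meets
    \<open>K\<close>.\<close>
  have reach_v: "reach E X w v" if w: "w \<in> major X" for w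
  proof -
    have "infinite {u \<in> U. reach E X w u}" using w unfolding major_def by blast
    then have "\<not> {u \<in> U. reach E X w u} \<subseteq> U \<inter> (V - K - X)"
      using small(1) finite_subset by blast
    then obtain u where u: "u \<in> U" "reach E X w u" "u \<notin> V - K - X" by blast
    moreover have "u \<notin> X" "u \<in> V"
      using reach_notin[OF u(2)] reach_in_V[OF u(2) g] w major_sub by auto
    ultimately have "reach E X u v" using reach_sym[OF g] unfolding K_def by auto
    then show ?thesis using reach_trans[OF u(2)] by blast
  qed
  show "v \<in> major X \<Longrightarrow> w \<in> major X \<Longrightarrow> reach E X v w" for v w
    by (rule reach_trans[OF reach_v reach_sym[OF g reach_v]])
  have "major X = K" using K reach_sym[OF g reach_v] unfolding K_def by blast
  then have eq: "U - major X - X = U \<inter> (V - K - X)" using U_sub by blast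
  have "U - major X \<subseteq> (U - major X - X) \<union> X" by blast
  then show "finite (U - major X)" using small(1) X unfolding eq by (auto dest: finite_subset)
  have "card (X \<inter> V) \<le> card X" using X by (intro card_mono) auto
  then show "card (U - major X - X) \<le> card X" using small(2) unfolding eq by linarith
qed

lemma reach_major_avoiding:
  assumes "v \<in> major X" "Y \<inter> major X = {}" "reach E X v w"
  shows "reach E Y v w"
  using assms(3)
proof (induction rule: reach_induct)
  case base
  show ?case by (rule reach_refl)
next
  case (step y z)
  have "y \<in> major X" "z \<in> major X"
    using major_closed[OF assms(1)] step reach_edge by metis+
  then show ?case using assms(2) step reach_edge[of E Y v y z] by blast
qed

text \<open>Components in \<open>major X\<close> stay connected when \<open>Y\<close> is deleted
  instead of \<open>X\<close>, provided that \<open>Y\<close> misses them; \<open>Y\<close> may be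
  incomparable with \<open>X\<close>.\<close>

lemma major_mono:
  assumes "Y \<inter> major X = {}"
  shows "major X \<subseteq> major Y"
proof
  fix v assume v: "v \<in> major X"
  have "{u \<in> U. reach E X v u} \<subseteq> {u \<in> U. reach E Y v u}"
    using reach_major_avoiding[OF v assms] by blast
  then show "v \<in> major Y"
    using v assms unfolding major_def by (auto dest: finite_subset)
qed

lemma infinite_major:
  assumes "finite X"
  shows "infinite (U \<inter> major X)"
proof
  assume "finite (U \<inter> major X)"
  then have "finite (U \<inter> major X \<union> (U - major X))" using finite_outside_major[OF assms] by blast
  moreover have "U \<inter> major X \<union> (U - major X) = U" by blast
  ultimately show False using U_inf by simp
qed

section \<open>Combs and rays that converge to the end\<close>

definition converges :: "(nat \<Rightarrow> 'v) \<Rightarrow> bool" where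
  "converges R \<longleftrightarrow> ray V E R \<and> (\<forall>X. finite X \<longrightarrow> (\<exists>n. \<forall>k\<ge>n. R k \<in> major X))"

lemma converges_equiv:
  assumes "converges R" "converges R'"
  shows "ray_equiv V E R R'"
proof -
  have "\<exists>n m. (\<forall>k\<ge>n. R k \<notin> X) \<and> (\<forall>k\<ge>m. R' k \<notin> X) \<and> connected_avoiding V E X (R n) (R' m)"
    if X: "finite X" for X
  proof -
    obtain n m where "\<forall>k\<ge>n. R k \<in> major X" "\<forall>k\<ge>m. R' k \<in> major X"
      using assms X unfolding converges_def by meson
    then show ?thesis
      using major_sub[of X] major_connected[OF X] unfolding connected_avoiding_iff[OF g] by blast
  qed
  then show ?thesis using assms unfolding ray_equiv_def converges_def by blast
qed

text \<open>All but finitely many of the disjoint paths avoid a given finite set. So the tail of the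
  spine reaches infinitely many teeth in \<open>G - X\<close> and lies in
  \<open>major X\<close>.\<close>

lemma comb_converges:
  assumes "comb V E R U"
  shows "converges R"
  unfolding converges_def
proof (intro conjI allI impI)
  show ray: "ray V E R" using assms unfolding comb_def by blast
  fix X :: "'v set" assume X: "finite X"
  obtain n where n: "\<forall>k\<ge>n. R k \<notin> X" using ray_tail_avoids[OF ray X] by blast
  obtain Ps where Ps: "infinite Ps"
    "\<And>p. p \<in> Ps \<Longrightarrow> gpath V E p \<and> set p \<inter> range R = {hd p} \<and> last p \<in> U"
    "\<And>p q. p \<in> Ps \<Longrightarrow> q \<in> Ps \<Longrightarrow> p \<noteq> q \<Longrightarrow> set p \<inter> set q = {}"
    using assms unfolding comb_def by metis
  \<comment> \<open>The initial segment is included so that the paths avoiding \<open>Y\<close>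
    start on the tail of \<open>R\<close>.\<close>
  define Y where "Y = X \<union> R ` {..<n}"
  have Y: "finite Y" using X unfolding Y_def by simp
  define Qs where "Qs = {p \<in> Ps. set p \<inter> Y = {}}"
  have "finite (Ps - Qs)"
  proof -
    have "\<forall>p\<in>Ps - Qs. \<exists>x. x \<in> set p \<inter> Y" unfolding Qs_def by blast
    then obtain h where h: "\<forall>p\<in>Ps - Qs. h p \<in> set p \<inter> Y" by metis
    then have "inj_on h (Ps - Qs)" using Ps(3) unfolding inj_on_def by (metis DiffD1 IntD1 disjoint_iff)
    moreover have "h ` (Ps - Qs) \<subseteq> Y" using h by blast
    ultimately show ?thesis using Y by (meson finite_imageD finite_subset)
  qed
  then have "infinite Qs" using Ps(1) by (metis finite_Diff2 finite_Un Qs_def)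
  moreover have "inj_on last Qs"
    using Ps(2,3) unfolding Qs_def inj_on_def gpath_iff
    by (metis (no_types, lifting) mem_Collect_eq disjoint_iff last_in_set)
  ultimately have "infinite (last ` Qs)" by (simp add: finite_image_iff)
  moreover have "last ` Qs \<subseteq> {u \<in> U. reach E X (R n) u}"
  proof
    fix u assume "u \<in> last ` Qs"
    then obtain p where p: "p \<in> Ps" "set p \<inter> Y = {}" "u = last p" unfolding Qs_def by blast
    have hd: "hd p \<in> set p" "hd p \<in> range R" using Ps(2)[OF p(1)] by auto
    then obtain k where k: "hd p = R k" by blast
    then have "n \<le> k" using hd(1) p(2) unfolding Y_def by fastforce
    then have "reach E X (R n) (hd p)" unfolding k by (intro reach_ray_tail[OF g ray n]) auto
    moreover have "reach E X (hd p) u"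
      unfolding p(3) using Ps(2)[OF p(1)] p(2) unfolding gpath_iff Y_def
      by (intro reach_of_walk) auto
    ultimately have "reach E X (R n) u" by (rule reach_trans)
    then show "u \<in> {u \<in> U. reach E X (R n) u}" using Ps(2)[OF p(1)] p(3) by blast
  qed
  ultimately have "infinite {u \<in> U. reach E X (R n) u}" using finite_subset by blast
  then have "R n \<in> major X" using n ray unfolding major_def ray_def by auto
  then show "\<exists>n. \<forall>k\<ge>n. R k \<in> major X"
    using major_closed reach_ray_tail[OF g ray n] by (metis order_refl)
qed

text \<open>For finite \<open>S\<close>, both \<open>R\<close> and \<open>U\<close> meet the
  connected set \<open>major S\<close>. A path between them, cut at its last vertex on
  \<open>R\<close>, is a further path of the comb that avoids \<open>S\<close>.\<close>

lemma converges_comb: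
  assumes "converges R"
  shows "comb V E R U"
proof -
  have ray: "ray V E R" using assms unfolding converges_def by blast
  have "\<exists>p. (gpath V E p \<and> set p \<inter> range R = {hd p} \<and> last p \<in> U) \<and> p \<noteq> [] \<and> set p \<inter> S = {}"
    if S: "finite S" for S
  proof -
    obtain n where n: "R n \<in> major S" using assms S unfolding converges_def by blast
    obtain u where u: "u \<in> U" "u \<in> major S" using infinite_major[OF S]
      by (metis IntE ex_in_conv finite.emptyI)
    obtain xs where xs: "gpath V E xs" "hd xs = R n" "last xs = u" "set xs \<inter> S = {}"
      using gpath_of_reach[OF g _ _ major_connected[OF S n u(2)]] major_sub n by blast
    then have "\<exists>x\<in>set xs. x \<in> range R" unfolding gpath_iff by (metis hd_in_set rangeI)
    then obtain ys v zs where s: "xs = ys @ v # zs" "v \<in> range R" "\<forall>y\<in>set zs. y \<notin> range R"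
      using split_list_last_prop[of xs "\<lambda>x. x \<in> range R"] by blast
    have "gpath V E (v # zs)"
      using xs(1) s(1) unfolding gpath_iff by (auto simp: successively_append_iff)
    moreover have "set (v # zs) \<inter> range R = {hd (v # zs)}" using s by auto
    moreover have "last (v # zs) \<in> U" using xs(3) s(1) u(1) by simp
    moreover have "set (v # zs) \<inter> S = {}" using xs(4) s(1) by auto
    ultimately show ?thesis by blast
  qed
  from infinite_disjoint_lists[of "\<lambda>p. gpath V E p \<and> set p \<inter> range R = {hd p} \<and> last p \<in> U", OF this]
  show ?thesis using ray unfolding comb_def by blast
qed

section \<open>Minimum separators between finite sets and the end\<close>

text \<open>\<open>S \<inter> major Z = {}\<close> says that \<open>Z\<close> separates \<open>S\<close> from the end to which \<open>U\<close> converges.\<close>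

definition min_separator :: "'v set \<Rightarrow> 'v set \<Rightarrow> bool" where
  "min_separator S Z \<longleftrightarrow> finite Z \<and> Z \<subseteq> V \<and> S \<inter> major Z = {} \<and>
     (\<forall>Z'. finite Z' \<longrightarrow> S \<inter> major Z' = {} \<longrightarrow> card Z \<le> card Z')"

lemma ex_min_separator:
  assumes "finite S"
  shows "\<exists>Z. min_separator S Z"
proof -
  \<comment> \<open>\<open>S \<inter> V\<close> separates \<open>S\<close> trivially, so a separator
    of least size exists; afterwards it is cut down to \<open>V\<close>.\<close>
  have "finite (S \<inter> V)" "S \<inter> major (S \<inter> V) = {}"
    using assms major_sub[of "S \<inter> V"] by blast+
  then obtain Z where Z: "finite Z" "S \<inter> major Z = {}"
    and min: "\<And>Z'. finite Z' \<Longrightarrow> S \<inter> major Z' = {} \<Longrightarrow> card Z \<le> card Z'"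
    using ex_has_least_nat[of "\<lambda>Z. finite Z \<and> S \<inter> major Z = {}" "S \<inter> V" card] by auto
  have "major (Z \<inter> V) \<subseteq> major Z"
    by (rule major_mono) (use major_sub[of "Z \<inter> V"] in blast)
  then have "S \<inter> major (Z \<inter> V) = {}" using Z(2) by blast
  moreover have "card (Z \<inter> V) \<le> card Z" using Z(1) by (intro card_mono) auto
  ultimately show ?thesis
    using Z min unfolding min_separator_def by (intro exI[of _ "Z \<inter> V"]) (auto intro: order_trans)
qed

text \<open>Otherwise \<open>z\<close> could be dropped: \<open>major (Z - {z})\<close> reaches a
  vertex of \<open>major Z\<close>, and a walk in \<open>G - (Z - {z})\<close> can leave
  \<open>major Z\<close> only through \<open>z\<close>, which has no neighbour there.\<close>

lemma min_separator_boundary: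
  assumes Z: "min_separator S Z" and z: "z \<in> Z"
  shows "\<exists>w\<in>major Z. E z w"
proof (rule ccontr)
  assume neg: "\<not> ?thesis"
  have fin: "finite Z" using Z unfolding min_separator_def by blast
  have "major (Z - {z}) \<subseteq> major Z"
  proof
    fix v assume v: "v \<in> major (Z - {z})"
    have "\<not> {u \<in> U. reach E (Z - {z}) v u} \<subseteq> U - major Z"
      using v finite_outside_major[OF fin] unfolding major_def by (auto dest: finite_subset)
    then obtain u where u: "u \<in> major Z" "reach E (Z - {z}) v u" by blast
    then have "reach E (Z - {z}) u v" using reach_sym[OF g] by blast
    then show "v \<in> major Z" using u(1)
    proof (induction rule: reach_induct)
      case base
      then show ?case by blast
    next
      case (step x y)
      then have "y \<in> Z" if "y \<notin> major Z" using major_boundary[of y x Z] edge_sym that by blast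
      then show ?case using step neg edge_sym by blast
    qed
  qed
  then have "S \<inter> major (Z - {z}) = {}" using Z unfolding min_separator_def by blast
  then have "card Z \<le> card (Z - {z})" using Z fin unfolding min_separator_def by blast
  then show False using fin z by (meson card_Diff1_less linorder_not_le)
qed

lemma card_le_separator:
  assumes "finite Z" "Y \<subseteq> U" "Y \<inter> major Z = {}"
  shows "card Y \<le> 2 * card Z"
proof -
  have fin: "finite (U - major Z - Z)" using finite_outside_major[OF assms(1)] by blast
  have "card Y \<le> card ((U - major Z - Z) \<union> Z)"
    using assms fin by (intro card_mono) auto
  also have "\<dots> \<le> card (U - major Z - Z) + card Z" by (rule card_Un_le)
  finally show ?thesis using card_outside_major[OF assms(1)] by linarith
qed

lemma ex_larger_min_separator:
  assumes "finite S" "finite Z"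
  shows "\<exists>S' Z'. finite S' \<and> min_separator S' Z' \<and> S \<union> Z \<union> (\<Union>v\<in>S \<union> Z. {w. E v w}) \<subseteq> S' \<and>
    card Z < card Z'"
proof -
  obtain Y where Y: "Y \<subseteq> U" "finite Y" "card Y = 2 * card Z + 1"
    using infinite_arbitrarily_large[OF U_inf] by metis
  \<comment> \<open>The neighbours make consecutive separators disjoint; the
    \<open>2 * card Z + 1\<close> vertices of \<open>Y\<close> force the new separator to be larger,
    by \<open>card_le_separator\<close>.\<close>
  define S' where "S' = S \<union> Z \<union> (\<Union>v\<in>S \<union> Z. {w. E v w}) \<union> Y"
  have "finite S'" unfolding S'_def using assms Y finite_neighbours by simp
  moreover obtain Z' where Z': "min_separator S' Z'" using ex_min_separator[OF \<open>finite S'\<close>] by blast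
  moreover have "card Y \<le> 2 * card Z'"
    using Z' Y unfolding min_separator_def S'_def by (intro card_le_separator) auto
  then have "card Z < card Z'" using Y(3) by linarith
  moreover have "S \<union> Z \<union> (\<Union>v\<in>S \<union> Z. {w. E v w}) \<subseteq> S'" unfolding S'_def by blast
  ultimately show ?thesis by blast
qed

lemma ex_separator_sequence:
  "\<exists>S Z. (\<forall>n. min_separator (S n) (Z n)) \<and> S 0 \<inter> V \<noteq> {} \<and> (\<forall>n. card (Z n) < card (Z (Suc n))) \<and>
    (\<forall>n. S n \<union> Z n \<union> (\<Union>v\<in>S n \<union> Z n. {w. E v w}) \<subseteq> S (Suc n))"
proof -
  obtain v0 where v0: "v0 \<in> U" using U_inf by fastforce
  obtain Z0 where Z0: "min_separator {v0} Z0" using ex_min_separator by blast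
  \<comment> \<open>Dependent choice of pairs; the clause for \<open>n = 0\<close> keeps the first
    set nonempty, from which the sets grow to exhaust \<open>V\<close>.\<close>
  have "\<exists>f. \<forall>n. ((finite (fst (f n)) \<and> min_separator (fst (f n)) (snd (f n))) \<and> (n = 0 \<longrightarrow> v0 \<in> fst (f n))) \<and>
     (fst (f n) \<union> snd (f n) \<union> (\<Union>v\<in>fst (f n) \<union> snd (f n). {w. E v w}) \<subseteq> fst (f (Suc n)) \<and>
      card (snd (f n)) < card (snd (f (Suc n))))"
  proof (rule dependent_nat_choice)
    show "\<exists>x. (finite (fst x) \<and> min_separator (fst x) (snd x)) \<and> ((0::nat) = 0 \<longrightarrow> v0 \<in> fst x)"
      using Z0 by (intro exI[of _ "({v0}, Z0)"]) simp
  next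
    fix x :: "'v set \<times> 'v set" and n :: nat
    assume "(finite (fst x) \<and> min_separator (fst x) (snd x)) \<and> (n = 0 \<longrightarrow> v0 \<in> fst x)"
    then have "finite (fst x)" "finite (snd x)" unfolding min_separator_def by auto
    then obtain S' Z' where "finite S'" "min_separator S' Z'"
      "fst x \<union> snd x \<union> (\<Union>v\<in>fst x \<union> snd x. {w. E v w}) \<subseteq> S'" "card (snd x) < card Z'"
      using ex_larger_min_separator by metis
    then show "\<exists>y. ((finite (fst y) \<and> min_separator (fst y) (snd y)) \<and> (Suc n = 0 \<longrightarrow> v0 \<in> fst y)) \<and>
      (fst x \<union> snd x \<union> (\<Union>v\<in>fst x \<union> snd x. {w. E v w}) \<subseteq> fst y \<and> card (snd x) < card (snd y))"
      by (intro exI[of _ "(S', Z')"]) simp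
  qed
  then obtain f where f: "\<And>n. min_separator (fst (f n)) (snd (f n))" "v0 \<in> fst (f 0)"
    "\<And>n. card (snd (f n)) < card (snd (f (Suc n)))"
    "\<And>n. fst (f n) \<union> snd (f n) \<union> (\<Union>v\<in>fst (f n) \<union> snd (f n). {w. E v w}) \<subseteq> fst (f (Suc n))"
    by blast
  have "fst (f 0) \<inter> V \<noteq> {}" using f(2) v0 U_sub by blast
  then show ?thesis
    using f(1,3,4) by (intro exI[of _ "\<lambda>n. fst (f n)"] exI[of _ "\<lambda>n. snd (f n)"] conjI allI)
qed

end

section \<open>Disjoint rays\<close>

locale separator_sequence = concentrated_set +
  fixes S Z :: "nat \<Rightarrow> 'a set"
  assumes min_sep: "\<And>n. min_separator (S n) (Z n)" and S0: "S 0 \<inter> V \<noteq> {}"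
    and card_Z: "\<And>n. card (Z n) < card (Z (Suc n))"
    and S_Suc: "\<And>n. S n \<union> Z n \<union> (\<Union>v\<in>S n \<union> Z n. {w. E v w}) \<subseteq> S (Suc n)"
begin

definition region :: "nat \<Rightarrow> 'a set" where
  "region n = major (Z n) \<union> Z n"

lemma finite_Z: "finite (Z n)" and Z_sub: "Z n \<subseteq> V" and S_major: "S n \<inter> major (Z n) = {}"
  using min_sep[of n] unfolding min_separator_def by auto

lemma Z_major: "Z n \<inter> major (Z n) = {}"
  using major_sub by blast

lemma Z_major_Suc: "Z n \<inter> major (Z (Suc n)) = {}"
  using S_Suc[of n] S_major[of "Suc n"] by blast

lemma major_Suc: "major (Z (Suc n)) \<subseteq> major (Z n)"
  by (rule major_mono[OF Z_major_Suc])

text \<open>By minimality \<open>z\<close> has a neighbour \<open>w\<close> beyond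
  \<open>Z (Suc n)\<close>. If \<open>z\<close> were not in \<open>major (Z n)\<close>, it would lie
  in \<open>Z n\<close>, and then \<open>w\<close> in \<open>S (Suc n)\<close>, which is separated
  from the end.\<close>

lemma Z_Suc_major: "Z (Suc n) \<subseteq> major (Z n)"
proof
  fix z assume z: "z \<in> Z (Suc n)"
  obtain w where w: "w \<in> major (Z (Suc n))" "E z w"
    using min_separator_boundary[OF min_sep z] by blast
  show "z \<in> major (Z n)"
  proof (rule ccontr)
    assume "z \<notin> major (Z n)"
    then have "z \<in> Z n" using major_boundary[OF w(2)] w(1) major_Suc by blast
    then have "w \<in> S (Suc n)" using S_Suc[of n] w(2) by blast
    then show False using S_major[of "Suc n"] w(1) by blast
  qed
qed

lemma region_Suc: "region (Suc n) \<subseteq> major (Z n)"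
  using Z_Suc_major major_Suc unfolding region_def by blast

lemma region_antimono: "m \<le> n \<Longrightarrow> region n \<subseteq> region m"
  by (rule lift_Suc_antimono_le[of region]) (use region_Suc in \<open>auto simp: region_def\<close>)

lemma S_exhausts:
  assumes "finite X"
  shows "\<exists>n. X \<inter> V \<subseteq> S n"
proof -
  have mono: "m \<le> n \<Longrightarrow> S m \<subseteq> S n" for m n
    by (rule lift_Suc_mono_le[of S]) (use S_Suc in blast)
  have single: "\<exists>n. v \<in> S n" if v: "v \<in> V" for v
  proof -
    obtain v0 where v0: "v0 \<in> S 0" "v0 \<in> V" using S0 by blast
    have "E\<^sup>*\<^sup>* v0 v" by (rule rtranclp_connected[OF conn v0(2) v])
    then show ?thesis
    proof (induction rule: rtranclp_induct)
      case base
      then show ?case using v0 by blast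
    next
      case (step y z)
      then obtain n where "y \<in> S n" by blast
      then have "z \<in> S (Suc n)" using S_Suc[of n] step.hyps(2) by blast
      then show ?case by blast
    qed
  qed
  show ?thesis using assms
  proof (induction X rule: finite_induct)
    case (insert x X)
    then obtain n where n: "X \<inter> V \<subseteq> S n" by blast
    show ?case
    proof (cases "x \<in> V")
      case True
      then obtain m where "x \<in> S m" using single by blast
      then have "insert x X \<inter> V \<subseteq> S (max m n)"
        using n mono[of m "max m n"] mono[of n "max m n"] by auto
      then show ?thesis by blast
    qed (use n in auto)
  qed auto
qed

lemma region_converges:
  assumes "finite X"
  shows "\<exists>n. region n \<subseteq> major X"
proof -
  obtain n where "X \<inter> V \<subseteq> S n" using S_exhausts[OF assms] by blast
  then have "X \<inter> major (Z n) = {}" using S_major[of n] major_sub[of "Z n"] by blast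
  then show ?thesis using major_mono[of X "Z n"] region_Suc[of n] by blast
qed

text \<open>The graph between two consecutive separators, both included.\<close>

definition corridor :: "nat \<Rightarrow> 'a \<Rightarrow> 'a \<Rightarrow> bool" where
  "corridor n a b \<longleftrightarrow> E a b \<and> a \<in> region n - major (Z (Suc n)) \<and> b \<in> region n - major (Z (Suc n))"

lemma card_Z_le_separator:
  assumes W: "finite W" "separator (corridor n) (Z n) (Z (Suc n)) W"
  shows "card (Z n) \<le> card W"
proof -
  \<comment> \<open>A walk from \<open>S n\<close> to the end contains a corridor walk from \<open>Z n\<close> to \<open>Z (Suc n)\<close>, so \<open>W\<close> competes
    with \<open>Z n\<close> in the minimality of \<open>Z n\<close>.\<close>
  have "S n \<inter> major W = {}"
  proof (rule ccontr)
    assume "S n \<inter> major W \<noteq> {}"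
    then obtain s where s: "s \<in> S n" "s \<in> major W" by blast
    have sW: "s \<notin> W" using s(2) major_sub by blast
    have "infinite {u \<in> U. reach E W s u}" using s(2) unfolding major_def by blast
    then have "\<not> {u \<in> U. reach E W s u} \<subseteq> U - major (Z (Suc n))"
      using finite_outside_major[OF finite_Z] finite_subset by blast
    then obtain u where u: "u \<in> major (Z (Suc n))" "reach E W s u" by blast
    have start: "walk (corridor n) (Z n) {v} [v]" if "v \<in> Z n" for v
      using that unfolding walk_def by simp
    \<comment> \<open>Invariant along a walk from \<open>s\<close> in \<open>G - W\<close>: it
      enters \<open>region n\<close> only through \<open>Z n\<close>, and inside the region its last
      piece is a corridor walk avoiding \<open>W\<close>.\<close>
    have "u \<notin> major (Z (Suc n)) \<and>
      (u \<in> region n \<longrightarrow> (\<exists>p. walk (corridor n) (Z n) {u} p \<and> set p \<inter> W = {}))"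
      using u(2)
    proof (induction rule: reach_induct)
      case base
      have "s \<notin> major (Z n)" using s(1) S_major by blast
      moreover have "\<exists>p. walk (corridor n) (Z n) {s} p \<and> set p \<inter> W = {}" if "s \<in> Z n"
        using start[OF that] sW by (intro exI[of _ "[s]"]) simp
      ultimately show ?case using major_Suc unfolding region_def by blast
    next
      case (step v w)
      have w: "w \<notin> major (Z (Suc n))"
      proof
        assume wm: "w \<in> major (Z (Suc n))"
        then have v: "v \<in> Z (Suc n)" using major_boundary[OF step.hyps(2)] step.IH by blast
        then have "v \<in> region n" using Z_Suc_major unfolding region_def by blast
        then obtain p where p: "walk (corridor n) (Z n) {v} p" "set p \<inter> W = {}"
          using step.IH by blast
        then have "walk (corridor n) (Z n) (Z (Suc n)) p" using v unfolding walk_def by auto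
        then show False using W(2) p(2) unfolding separator_def by blast
      qed
      moreover have "\<exists>p. walk (corridor n) (Z n) {w} p \<and> set p \<inter> W = {}" if wr: "w \<in> region n"
      proof (cases "w \<in> Z n")
        case True
        then show ?thesis using start step.hyps(4) by (intro exI[of _ "[w]"]) simp
      next
        case False
        then have "w \<in> major (Z n)" using wr unfolding region_def by blast
        then have v: "v \<in> region n"
          using major_boundary[OF step.hyps(2)] unfolding region_def by blast
        then obtain p where p: "walk (corridor n) (Z n) {v} p" "set p \<inter> W = {}"
          using step.IH by blast
        have "corridor n v w" using step.hyps(2) step.IH v w wr unfolding corridor_def by blast
        then have "walk (corridor n) (Z n) {w} (p @ [w])"
          using p(1) unfolding walk_def by (auto simp: successively_append_iff)
        then show ?thesis using p(2) step.hyps(4) by (intro exI[of _ "p @ [w]"]) auto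
      qed
      ultimately show ?case by blast
    qed
    then show False using u(1) by blast
  qed
  then show ?thesis using min_sep[of n] W(1) unfolding min_separator_def by blast
qed

lemma corridor_walk_set:
  assumes "successively (corridor n) p" "p \<noteq> []" "hd p \<in> Z n"
  shows "set p \<subseteq> region n - major (Z (Suc n))"
proof -
  have "set p \<subseteq> X" if "successively (\<lambda>a b. r a b \<and> b \<in> X) p" "p \<noteq> []" "hd p \<in> X" for r X
    using that by (induction p rule: induct_list012) auto
  moreover have "hd p \<in> region n - major (Z (Suc n))"
    using assms(3) Z_major_Suc unfolding region_def by blast
  moreover have "successively (\<lambda>a b. E a b \<and> b \<in> region n - major (Z (Suc n))) p"
    using assms(1) by (auto elim!: successively_mono simp: corridor_def)
  ultimately show ?thesis using assms(2) by blast
qed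

text \<open>Each Menger path is cut just before its first vertex \<open>\<sigma> z\<close> in
  \<open>Z (Suc n)\<close>. The remaining piece \<open>L z\<close> lies in the ring
  \<open>region n - region (Suc n)\<close>, so pieces from different rings are disjoint.\<close>

lemma ex_ring_linkage:
  "\<exists>L \<sigma>. (\<forall>z\<in>Z n. L z \<noteq> [] \<and> hd (L z) = z \<and> distinct (L z) \<and> successively E (L z @ [\<sigma> z]) \<and>
      \<sigma> z \<in> Z (Suc n) \<and> set (L z) \<subseteq> region n - region (Suc n)) \<and>
    (\<forall>z\<in>Z n. \<forall>z'\<in>Z n. z \<noteq> z' \<longrightarrow> \<sigma> z \<noteq> \<sigma> z' \<and> set (L z) \<inter> set (L z') = {})"
proof -
  obtain P where P: "linkage (corridor n) (Z n) (Z (Suc n)) P" "card P = card (Z n)"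
    using menger[OF finite_Z finite_Z card_Z_le_separator] by blast
  obtain p where p: "\<And>z. z \<in> Z n \<Longrightarrow> p z \<in> P \<and> hd (p z) = z"
    and pd: "\<And>z z'. z \<in> Z n \<Longrightarrow> z' \<in> Z n \<Longrightarrow> z \<noteq> z' \<Longrightarrow> set (p z) \<inter> set (p z') = {}"
    using linkage_bij_hd[OF P(1) finite_Z P(2)] by metis
  have "\<exists>q. set (fst q) \<subseteq> set (p z) \<and> snd q \<in> set (p z) \<and> fst q \<noteq> [] \<and> hd (fst q) = z \<and> distinct (fst q) \<and>
      successively E (fst q @ [snd q]) \<and> snd q \<in> Z (Suc n) \<and>
      set (fst q) \<subseteq> region n - region (Suc n)" if z: "z \<in> Z n" for z
  proof -
    have w: "walk (corridor n) (Z n) (Z (Suc n)) (p z)" "distinct (p z)"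
      using P(1) p[OF z] unfolding linkage_def by auto
    then have "set (p z) \<inter> Z (Suc n) \<noteq> {}" unfolding walk_def by (metis disjoint_iff last_in_set)
    then obtain p1 v p2 where s: "p z = p1 @ v # p2" "v \<in> Z (Suc n)" "set p1 \<inter> Z (Suc n) = {}"
      "walk (corridor n) (Z n) (Z (Suc n)) (p1 @ [v])"
      using walk_to_first[OF w(1)] by metis
    have ne: "p1 \<noteq> []"
    proof
      assume "p1 = []"
      then have "v = z" using s(1) p[OF z] by simp
      then show False using s(2) z Z_Suc_major[of n] Z_major[of n] by blast
    qed
    have "set (p z) \<subseteq> region n - major (Z (Suc n))"
      using corridor_walk_set[of n "p z"] w(1) unfolding walk_def by blast
    then have "set p1 \<subseteq> region n - region (Suc n)"
      using s(1,3) unfolding region_def[of "Suc n"] by auto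
    moreover have "hd p1 = z" using p[OF z] s(1) ne by simp
    moreover have "successively E (p1 @ [v])"
      using s(4) unfolding walk_def by (auto elim!: successively_mono simp: corridor_def)
    ultimately show ?thesis using s w(2) ne by (intro exI[of _ "(p1, v)"]) auto
  qed
  then obtain q where q: "\<And>z. z \<in> Z n \<Longrightarrow> set (fst (q z)) \<subseteq> set (p z) \<and> snd (q z) \<in> set (p z) \<and>
      fst (q z) \<noteq> [] \<and> hd (fst (q z)) = z \<and> distinct (fst (q z)) \<and>
      successively E (fst (q z) @ [snd (q z)]) \<and> snd (q z) \<in> Z (Suc n) \<and>
      set (fst (q z)) \<subseteq> region n - region (Suc n)"
    by metis
  have "snd (q z) \<noteq> snd (q z') \<and> set (fst (q z)) \<inter> set (fst (q z')) = {}"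
    if "z \<in> Z n" "z' \<in> Z n" "z \<noteq> z'" for z z'
    using q[OF that(1)] q[OF that(2)] pd[OF that] by (auto simp: disjoint_iff)
  then show ?thesis using q
    by (intro exI[of _ "\<lambda>z. fst (q z)"] exI[of _ "\<lambda>z. snd (q z)"]) blast
qed

text \<open>\<open>\<sigma> n\<close> injects \<open>Z n\<close> into the larger
  \<open>Z (Suc n)\<close> and so misses some \<open>y n\<close>. Following the linkages from each
  \<open>y k\<close> gives one ray per \<open>k\<close>.\<close>

lemma ex_disjoint_converging_rays:
  "\<exists>T. (\<forall>k::nat. converges (T k)) \<and> (\<forall>k l. k \<noteq> l \<longrightarrow> range (T k) \<inter> range (T l) = {})"
proof -
  have "\<forall>n. \<exists>q. (\<forall>z\<in>Z n. fst q z \<noteq> [] \<and> hd (fst q z) = z \<and> distinct (fst q z) \<and>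
      successively E (fst q z @ [snd q z]) \<and>
      snd q z \<in> Z (Suc n) \<and> set (fst q z) \<subseteq> region n - region (Suc n)) \<and>
    (\<forall>z\<in>Z n. \<forall>z'\<in>Z n. z \<noteq> z' \<longrightarrow> snd q z \<noteq> snd q z' \<and> set (fst q z) \<inter> set (fst q z') = {})"
    using ex_ring_linkage by simp
  then obtain q where q: "\<forall>n. (\<forall>z\<in>Z n. fst (q n) z \<noteq> [] \<and> hd (fst (q n) z) = z \<and>
      distinct (fst (q n) z) \<and> successively E (fst (q n) z @ [snd (q n) z]) \<and>
      snd (q n) z \<in> Z (Suc n) \<and> set (fst (q n) z) \<subseteq> region n - region (Suc n)) \<and>
    (\<forall>z\<in>Z n. \<forall>z'\<in>Z n. z \<noteq> z' \<longrightarrow> snd (q n) z \<noteq> snd (q n) z' \<and>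
      set (fst (q n) z) \<inter> set (fst (q n) z') = {})"
    by (rule choice[THEN exE])
  define L where "L n = fst (q n)" for n
  define \<sigma> where "\<sigma> n = snd (q n)" for n
  have L: "L n z \<noteq> []" "hd (L n z) = z" "distinct (L n z)" "successively E (L n z @ [\<sigma> n z])"
    "\<sigma> n z \<in> Z (Suc n)" "set (L n z) \<subseteq> region n - region (Suc n)" if "z \<in> Z n" for n z
    using q that unfolding L_def \<sigma>_def by auto
  have inj: "\<sigma> n z \<noteq> \<sigma> n z'" and Ldisj: "set (L n z) \<inter> set (L n z') = {}"
    if "z \<in> Z n" "z' \<in> Z n" "z \<noteq> z'" for n z z'
    using q that unfolding L_def \<sigma>_def by auto
  have "\<exists>y. y \<in> Z (Suc n) - \<sigma> n ` Z n" for n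
  proof -
    have "card (\<sigma> n ` Z n) < card (Z (Suc n))"
      using card_image_le[OF finite_Z, of "\<sigma> n" n] card_Z[of n] by linarith
    then have "\<not> Z (Suc n) \<subseteq> \<sigma> n ` Z n"
      using card_mono[of "\<sigma> n ` Z n" "Z (Suc n)"] finite_Z by (meson finite_imageI leD)
    then show ?thesis by blast
  qed
  then obtain y where y: "\<And>n. y n \<in> Z (Suc n) - \<sigma> n ` Z n" by metis
  \<comment> \<open>\<open>t k i\<close> is where the ray from \<open>y k\<close> meets
    \<open>Z (Suc k + i)\<close>; the shift by one is there because \<open>y k\<close> lies in
    \<open>Z (Suc k)\<close>.\<close>
  define t where "t k = rec_nat (y k) (\<lambda>i. \<sigma> (Suc k + i))" for k
  have t0: "t k 0 = y k" and tS: "t k (Suc i) = \<sigma> (Suc k + i) (t k i)" for k i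
    unfolding t_def by simp_all
  have tZ: "t k i \<in> Z (Suc k + i)" for k i
  proof (induction i)
    case 0
    then show ?case using y[of k] t0 by simp
  next
    case (Suc i)
    then show ?case using L(5)[OF Suc] tS by simp
  qed
  \<comment> \<open>Both vertices lie in the same separator. At \<open>i = 0\<close> they differ
    because \<open>y (Suc k + d)\<close> is outside the image of
    \<open>\<sigma> (Suc k + d)\<close>; injectivity keeps them apart later.\<close>
  have t_ne: "t k (Suc d + i) \<noteq> t (Suc k + d) i" for k d i
  proof (induction i)
    case 0
    have "t k (Suc d) \<in> \<sigma> (Suc k + d) ` Z (Suc k + d)" using tZ tS by blast
    then show ?case using y[of "Suc k + d"] t0 by (metis DiffD2 add_0_right)
  next
    case (Suc i)
    have "t k (Suc d + i) \<in> Z (Suc (Suc k + d) + i)" using tZ[of k "Suc d + i"] by (simp add: add_ac)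
    then show ?case
      using inj[OF _ tZ Suc] tS[of k "Suc d + i"] tS[of "Suc k + d" i] by (simp add: add_ac)
  qed
  define D where "D k i = L (Suc k + i) (t k i)" for k i
  have ring: "set (D k i) \<subseteq> region (Suc k + i) - region (Suc (Suc k + i))" for k i
    unfolding D_def by (rule L(6)[OF tZ])
  have ring_disj: "m = n" if "x \<in> region m - region (Suc m)" "x \<in> region n - region (Suc n)" for x m n
  proof (rule ccontr)
    assume "m \<noteq> n"
    then consider "Suc m \<le> n" | "Suc n \<le> m" by linarith
    then show False using that region_antimono by cases blast+
  qed
  have "\<exists>R. ray V E R \<and> range R \<subseteq> (\<Union>i. set (D k i))" for k
  proof (rule ray_of_blocks[of "D k" V E])
    show "D k i \<noteq> []" "distinct (D k i)" for i unfolding D_def by (rule L[OF tZ])+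
    show "set (D k i) \<inter> set (D k j) = {}" if "i \<noteq> j" for i j
    proof (rule ccontr)
      assume "\<not> ?thesis"
      then obtain x where "x \<in> set (D k i)" "x \<in> set (D k j)" by blast
      then have "Suc k + i = Suc k + j" using ring ring_disj by blast
      then show False using that by simp
    qed
    show "set (D k i) \<subseteq> V" for i
      using ring[of k i] major_sub Z_sub unfolding region_def by blast
    have "hd (D k (Suc i)) = \<sigma> (Suc k + i) (t k i)" for i
      unfolding D_def L(2)[OF tZ] by (rule tS)
    then show "successively E (D k i @ [hd (D k (Suc i))])" for i
      unfolding D_def using L(4)[OF tZ] by simp
  qed blast
  then obtain T where T: "\<And>k. ray V E (T k)" "\<And>k. range (T k) \<subseteq> (\<Union>i. set (D k i))" by metis
  have "converges (T k)" for k
    unfolding converges_def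
  proof (intro conjI allI impI)
    show "ray V E (T k)" by (rule T(1))
    fix X :: "'a set" assume X: "finite X"
    obtain N where N: "region N \<subseteq> major X" using region_converges[OF X] by blast
    have "finite (\<Union>i<N. set (D k i))" by simp
    from ray_tail_avoids[OF T(1) this, of k]
    obtain n where n: "\<forall>j\<ge>n. T k j \<notin> (\<Union>i<N. set (D k i))" by blast
    have "T k j \<in> major X" if j: "n \<le> j" for j
    proof -
      obtain i where i: "T k j \<in> set (D k i)" using T(2)[of k] by blast
      \<comment> \<open>Past \<open>n\<close> the ray has left its first \<open>N\<close> blocks, so
        it runs in rings inside \<open>region N\<close>.\<close>
      then have "N \<le> Suc k + i" using n j by fastforce
      then show ?thesis using i ring[of k i] region_antimono[of N "Suc k + i"] N by blast
    qed
    then show "\<exists>n. \<forall>j\<ge>n. T k j \<in> major X" by blast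
  qed
  moreover have disj: "range (T k) \<inter> range (T (Suc k + d)) = {}" for k d
  proof (rule ccontr)
    assume "\<not> ?thesis"
    then obtain x i j where x: "x \<in> set (D k i)" "x \<in> set (D (Suc k + d) j)"
      using T(2)[of k] T(2)[of "Suc k + d"] by blast
    \<comment> \<open>A common vertex lies in only one ring, so both blocks belong to the same
      linkage, where \<open>t_ne\<close> makes them disjoint.\<close>
    then have "Suc k + i = Suc (Suc k + d) + j" using ring ring_disj by blast
    then have i: "i = Suc d + j" by simp
    have "t k (Suc d + j) \<in> Z (Suc (Suc k + d) + j)" using tZ[of k "Suc d + j"] by (simp add: add_ac)
    from Ldisj[OF this tZ t_ne] show False
      using x unfolding D_def i by (auto simp: add_ac)
  qed
  moreover have "range (T k) \<inter> range (T l) = {}" if kl: "k \<noteq> l" for k l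
  proof (cases "k < l")
    case True
    then obtain d where "l = Suc k + d" using less_iff_Suc_add by auto
    then show ?thesis using disj by blast
  next
    case False
    then obtain d where "k = Suc l + d" using kl less_iff_Suc_add[of l k] by auto
    then show ?thesis using disj[of l d] by blast
  qed
  ultimately show ?thesis by blast
qed

end

section \<open>Uniqueness and thickness of the end\<close>

context concentrated_set
begin

lemma ex_disjoint_converging_rays:
  "\<exists>T. (\<forall>k::nat. converges (T k)) \<and> (\<forall>k l. k \<noteq> l \<longrightarrow> range (T k) \<inter> range (T l) = {})"
proof -
  obtain S Z where "separator_sequence V E U S Z"
    using ex_separator_sequence concentrated_set_axioms
    unfolding separator_sequence_def separator_sequence_axioms_def by metis
  then show ?thesis by (rule separator_sequence.ex_disjoint_converging_rays)
qed

text \<open>Combs with teeth in \<open>U\<close> are exactly those with convergent spine, and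
  convergent rays are pairwise equivalent. So they determine one end, which contains all the
  disjoint rays \<open>T k\<close>.\<close>

theorem unique_thick_end_in_closure:
  "(\<exists>!\<omega>. is_end V E \<omega> \<and> end_in_closure V E \<omega> U) \<and>
   (\<forall>\<omega>. is_end V E \<omega> \<and> end_in_closure V E \<omega> U \<longrightarrow> thick_end V E \<omega>)"
proof -
  obtain T where T: "\<And>k::nat. converges (T k)"
    and disj: "\<And>k l. k \<noteq> l \<Longrightarrow> range (T k) \<inter> range (T l) = {}"
    using ex_disjoint_converging_rays by blast
  define \<omega>0 where "\<omega>0 = {R. ray_equiv V E (T 0) R}"
  have T\<omega>: "T k \<in> \<omega>0" for k unfolding \<omega>0_def using converges_equiv[OF T T] by blast
  have "is_end V E \<omega>0"
    using T[of 0] unfolding is_end_def \<omega>0_def converges_def by blast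
  moreover have "end_in_closure V E \<omega>0 U"
    unfolding end_in_closure_def using T\<omega> converges_comb[OF T] by blast
  moreover have "\<omega> = \<omega>0" if \<omega>: "is_end V E \<omega>" "end_in_closure V E \<omega> U" for \<omega>
  proof -
    obtain R1 where R1: "\<omega> = {R. ray_equiv V E R1 R}" using \<omega>(1) unfolding is_end_def by blast
    obtain R where R: "R \<in> \<omega>" "comb V E R U" using \<omega>(2) unfolding end_in_closure_def by blast
    have "ray_equiv V E R (T 0)" using converges_equiv comb_converges R(2) T by blast
    then have "ray_equiv V E R1 (T 0)" using R(1) ray_equiv_trans[OF g] unfolding R1 by blast
    then show ?thesis
      unfolding R1 \<omega>0_def using ray_equiv_trans[OF g] ray_equiv_sym[OF g] by blast
  qed
  moreover have "thick_end V E \<omega>0"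
  proof -
    have "inj T"
    proof (rule injI, rule ccontr)
      fix k l assume "T k = T l" "k \<noteq> l"
      then show False using disj[of k l] by simp
    qed
    then have "infinite (range T)" by (rule range_inj_infinite)
    moreover have "\<forall>R\<in>range T. \<forall>R'\<in>range T. R \<noteq> R' \<longrightarrow> range R \<inter> range R' = {}"
      using disj by (metis imageE)
    ultimately show ?thesis
      unfolding thick_end_def using \<open>is_end V E \<omega>0\<close> T\<omega> by (metis image_subsetI)
  qed
  ultimately show ?thesis by blast
qed

end

theorem theorem2:
  fixes V :: "'v set" and E :: "'v \<Rightarrow> 'v \<Rightarrow> bool"
    and N :: "'v set set set" and f :: "nat \<Rightarrow> 'v set \<times> 'v set"
  assumes "graph V E" and "connected_graph V E" and "locally_finite V E"
    and "tree_of_tangles V E N"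
    and "\<And>i. sep_less (f i) (f (Suc i))"
    and "\<And>i. {fst (f i), snd (f i)} \<in> N"
    and "A = (\<Union>i. fst (f i))" and "B = (\<Inter>i. snd (f i))"
    and "B \<noteq> {}"
  shows "(\<exists>!\<omega>. is_end V E \<omega> \<and> end_in_closure V E \<omega> (A \<inter> B)) \<and>
           (\<forall>\<omega>. is_end V E \<omega> \<and> end_in_closure V E \<omega> (A \<inter> B) \<longrightarrow> thick_end V E \<omega>)"
proof -
  have split: "\<exists>P Q. tangles_split_by V E (fst (f i)) (snd (f i)) P Q" for i
  proof -
    obtain P Q where "tangle V E P" "tangle V E Q"
      "eff_distinguishes V E {fst (f i), snd (f i)} P Q"
      using assms(4,6) unfolding tree_of_tangles_def by blast
    then show ?thesis by (rule eff_distinguishes_splits[OF assms(1)])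
  qed
  have less: "sep_less (fst (f i), snd (f i)) (fst (f (Suc i)), snd (f (Suc i)))" for i
    using assms(5)[of i] by simp
  interpret chain: separation_chain V E "\<lambda>i. fst (f i)" "\<lambda>i. snd (f i)" A B
    by (unfold_locales; fact)
  \<comment> \<open>From here on the tangles enter only through the infinity of
    \<open>A \<inter> B\<close> and the bound \<open>limit_unbalanced\<close>.\<close>
  interpret concentrated_set V E "A \<inter> B"
    by (unfold_locales; fact assms(1-3) chain.limit_subset_V chain.infinite_limit chain.limit_unbalanced)
  show ?thesis by (rule unique_thick_end_in_closure)
qed

end
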